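(* Let $T_0>0$. Then there exist constants $c_1,c_2,c_3\in(0,\infty)$, depending only on $T_0$, such that for all $T\ge T_0$ and all $s\ge 0$, $$1-F^{\mathrm{edge}}_{T,0}(s)\;\le\; c_1\left(e^{-c_2T^{1/3}s}+e^{-c_3s^{3/2}}\right).$$
   Context: For $T>0$ put $\kappa_T=2^{-1/3}T^{1/3}$. All contour integrals below (in $z$ and in $\tilde\mu$) are written with their factor $\frac1{2\pi i}$. $\Gamma$-deformed Airy functions: for $a\in\mathbb{R}$, $b>0$, $c\ge 0$, $$\mathrm{Ai}^{\Gamma}(a,b,c)=\frac1{2\pi i}\int_{\tilde\Gamma_\zeta}e^{-\frac13z^3+az}\,\Gamma(bz+c)\,dz,\qquad \mathrm{Ai}_{\Gamma}(a,b,c)=\frac1{2\pi i}\int_{\tilde\Gamma_\eta}e^{\frac13z^3-az}\,\frac{1}{\Gamma(bz+c)}\,dz,$$ where $\Gamma(\cdot)$ is Euler's gamma function. The contour $\tilde\Gamma_\zeta$ goes from $\infty e^{-3\pi i/4}$ to $\infty e^{3\pi i/4}$, passing to the right of all poles of $z\mapsto\Gamma(bz+c)$ (for $c=0$ it therefore crosses the real axis at a point $>0$). The contour $\tilde\Gamma_\eta$ is a vertical line $\{\delta+ir: r\in\mathbb{R}\}$, $\delta>0$, oriented upward. The contour $\tilde{\mathcal C}$ is $\{x+i:x\ge0\}\cup\{e^{i\theta}:\pi/2\le\theta\le 3\pi/2\}\cup\{x-i:x\ge0\}$, traversed from $+\infty+i$ to $i$, then counterclockwise along the left unit semicircle to $-i$,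 then to $+\infty-i$. For $\tilde\mu\in\tilde{\mathcal C}$ define the kernel $$\tilde K_{T,\tilde\mu}(x,y)=\int_{-\infty}^{\infty}\frac{\tilde\mu}{\tilde\mu-e^{-\kappa_Tt}}\,\mathrm{Ai}^{\Gamma}(x+t,\kappa_T^{-1},0)\,\mathrm{Ai}_{\Gamma}(y+t,\kappa_T^{-1},0)\,dt .$$ The edge crossover distribution (at the edge of the rarefaction fan, with spatial parameter $X=0$) is, for each $T>0$, the cumulative distribution function $s\mapsto F^{\mathrm{edge}}_{T,0}(s)$ of a real random variable (in particular it takes values in $[0,1]$), given by $$1-F^{\mathrm{edge}}_{T,0}(s)=-\frac{1}{2\pi i}\int_{\tilde{\mathcal C}}e^{-\tilde\mu}\,\frac{d\tilde\mu}{\tilde\mu}\,\Big[\det(I-\tilde K_{T,\tilde\mu})_{L^2(s,\infty)}-1\Big].$$ Here the Fredholm determinant is understood as that of the conjugated trace-class operator $U^{-1}\tilde K_{T,\tilde\mu}U$ on $L^2(s,\infty)$, with $(Uf)(x)=(x^4+1)^{1/2}f(x)$, i.e. with kernel $(x^4+1)^{-1/2}\tilde K_{T,\tilde\mu}(x,y)(y^4+1)^{1/2}$. *)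

theory Defs
  imports
    "HOL-Complex_Analysis.Complex_Analysis"
    "Jordan_Normal_Form.Determinant"
begin

definition kappa :: "real \<Rightarrow> real" where
  "kappa T = 2 powr (-1/3) * T powr (1/3)"

text \<open>Integral of \<open>f\<close> along the ray \<open>p + r w\<close>, \<open>r\<close> from \<open>0\<close> to \<open>\<infinity>\<close>.\<close>

definition ray_integral :: "complex \<Rightarrow> complex \<Rightarrow> (complex \<Rightarrow> complex) \<Rightarrow> complex" where
  "ray_integral p w f = (LINT r:{0..}|lborel. f (p + of_real r * w) * w)"

text \<open>The contour of \<open>Ai_Gamma_upper\<close> comes in from infinity at angle \<open>-3\<pi>/4\<close> to the point \<open>1\<close>
  and leaves at angle \<open>3\<pi>/4\<close>; for \<open>b > 0\<close> and \<open>c \<ge> 0\<close> all poles of \<open>\<lambda>z. Gamma (b z + c)\<close> lie on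
  \<open>(-\<infinity>, 0]\<close>, to its left.  The contour of \<open>Ai_Gamma_lower\<close> is the upward vertical line
  through \<open>1\<close>.  By Cauchy's theorem the integrals do not depend on the choice of the crossing
  point \<open>1\<close> among the positive reals.\<close>

definition Ai_Gamma_upper :: "real \<Rightarrow> real \<Rightarrow> real \<Rightarrow> complex" where
  "Ai_Gamma_upper a b c =
     (let f = (\<lambda>z. exp (- (z ^ 3 / 3) + of_real a * z) * Gamma (of_real b * z + of_real c))
      in 1 / (2 * of_real pi * \<i>) *
         (ray_integral 1 (cis (3 * pi / 4)) f - ray_integral 1 (cis (- (3 * pi / 4))) f))"

definition Ai_Gamma_lower :: "real \<Rightarrow> real \<Rightarrow> real \<Rightarrow> complex" where
  "Ai_Gamma_lower a b c =
     (let f = (\<lambda>z. exp (z ^ 3 / 3 - of_real a * z) * (1 / Gamma (of_real b * z + of_real c)))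
      in 1 / (2 * of_real pi * \<i>) * (ray_integral 1 \<i> f - ray_integral 1 (- \<i>) f))"

text \<open>Integral along the contour running from \<open>+\<infinity> + \<i>\<close> to \<open>\<i>\<close>, counterclockwise along the left
  unit semicircle to \<open>-\<i>\<close>, and on to \<open>+\<infinity> - \<i>\<close>.\<close>

definition C_integral :: "(complex \<Rightarrow> complex) \<Rightarrow> complex" where
  "C_integral f =
     - ray_integral \<i> 1 f
     + contour_integral (part_circlepath 0 1 (pi / 2) (3 * pi / 2)) f
     + ray_integral (- \<i>) 1 f"

definition K_edge :: "real \<Rightarrow> complex \<Rightarrow> real \<Rightarrow> real \<Rightarrow> complex" where
  "K_edge T \<mu> x y =
     (LINT t|lborel. \<mu> / (\<mu> - of_real (exp (- kappa T * t)))
        * Ai_Gamma_upper (x + t) (1 / kappa T) 0 * Ai_Gamma_lower (y + t) (1 / kappa T) 0)"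

text \<open>Kernel of \<open>U\<inverse> K U\<close>, where \<open>(U f) x = sqrt (x\<^sup>4 + 1) * f x\<close>.\<close>

definition K_edge_conj :: "real \<Rightarrow> complex \<Rightarrow> real \<Rightarrow> real \<Rightarrow> complex" where
  "K_edge_conj T \<mu> x y =
     of_real (1 / sqrt (x ^ 4 + 1)) * K_edge T \<mu> x y * of_real (sqrt (y ^ 4 + 1))"

text \<open>\<open>fredholm_det M k\<close> is \<open>det (I - K)\<close> on \<open>L\<^sup>2(M)\<close> for the integral operator \<open>K\<close> with
  kernel \<open>k\<close>, given by the Fredholm series
  \<open>\<Sum>n. (-1)^n / n! * \<integral> det (k (x i) (x j)), i, j < n, dx 0 \<dots> dx (n - 1)\<close>.\<close>

definition fredholm_det :: "'a measure \<Rightarrow> ('a \<Rightarrow> 'a \<Rightarrow> complex) \<Rightarrow> complex" where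
  "fredholm_det M k =
     (\<Sum>n. (-1) ^ n / fact n *
        (LINT x|PiM {..<n} (\<lambda>_. M). Determinant.det (Matrix.mat n n (\<lambda>(i, j). k (x i) (x j)))))"

text \<open>The distribution function at spatial parameter \<open>0\<close>.  By conjugation symmetry
  of the contour the argument of \<open>Re\<close> is real, so \<open>Re\<close> only converts its type.\<close>

definition F_edge :: "real \<Rightarrow> real \<Rightarrow> real" where
  "F_edge T s =
     1 - Re (- (1 / (2 * of_real pi * \<i>)) *
       C_integral (\<lambda>\<mu>. exp (- \<mu>) / \<mu> *
         (fredholm_det (restrict_space lborel {s<..}) (K_edge_conj T \<mu>) - 1)))"

end

theory Submission
  imports
    Defs
    "Jordan_Normal_Form.Schur_Decomposition"
    "HOL-Probability.Sinc_Integral"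
    "HOL-Real_Asymp.Real_Asymp"
begin

text \<open>Write \<open>\<kappa>\<close> for \<open>kappa T\<close>.  Moving the contour of \<open>Ai_Gamma_upper\<close> to \<open>Re z = - \<epsilon>\<close>
  crosses only the pole at \<open>0\<close>, so this function is \<open>O(\<kappa> (1 + exp (- \<epsilon> a)))\<close>; moving the line of
  \<open>Ai_Gamma_lower\<close> to \<open>Re z = max (sqrt a) \<epsilon>\<close> gives \<open>O(\<kappa>\<inverse> exp (- a powr (3/2) / 2))\<close> for
  \<open>a \<ge> 0\<close> and \<open>O(\<kappa>\<inverse> exp (- \<epsilon> a))\<close> for \<open>a < 0\<close>, because \<open>1/\<Gamma>\<close> grows only exponentially on
  vertical lines.  The weight \<open>\<mu> / (\<mu> - exp (- \<kappa> t))\<close> decays like \<open>\<bar>\<mu>\<bar> exp (\<kappa> t)\<close> as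
  \<open>t \<rightarrow> - \<infinity>\<close>, and its peak of height \<open>\<bar>\<mu>\<bar>\<close> at \<open>exp (- \<kappa> t) \<approx> Re \<mu>\<close> is so narrow that it
  contributes only \<open>log \<bar>\<mu>\<bar>\<close> to the integral over \<open>t\<close>.  For nonnegative \<open>x\<close> and \<open>y\<close> the kernel is
  therefore \<open>O(\<bar>\<mu>\<bar> powr (1/4) (exp (- c \<kappa> y) + exp (- c y powr (3/2))))\<close>.  Hadamard's inequality
  bounds the Fredholm determinant minus one by the decay factor at \<open>s\<close> times
  \<open>exp (C \<bar>\<mu>\<bar> powr (1/2))\<close>, which is integrable against \<open>exp (- \<mu>) / \<mu>\<close> along the contour.

  Only upper bounds are needed, and a nonintegrable function has integral \<open>0\<close>, so most integrals
  can be estimated without any proof of measurability.\<close>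

subsection \<open>Hadamard's inequality and Fredholm determinants\<close>

text \<open>Hadamard's inequality, by AM-GM for the eigenvalues of \<open>B B\<^sup>*\<close>.\<close>
lemma cmod_det_le:
  fixes B :: "complex Matrix.mat"
  assumes B: "B \<in> carrier_mat n n"
    and le: "\<And>i j. i < n \<Longrightarrow> j < n \<Longrightarrow> cmod (B $$ (i, j)) \<le> 1"
  shows "(cmod (Determinant.det B))\<^sup>2 \<le> real n ^ n"
proof (cases "n = 0")
  case True
  then show ?thesis using B by simp
next
  case False
  \<comment> \<open>\<open>G\<close> is \<open>B\<close> times its conjugate transpose: its
    determinant is the squared modulus of the determinant of \<open>B\<close>, its trace the sum of
    the squared moduli of all entries of \<open>B\<close>.\<close>
  define C where "C = transpose_mat (map_mat cnj B)"
  define G where "G = B * C"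
  have C: "C \<in> carrier_mat n n" and G: "G \<in> carrier_mat n n"
    using B by (auto simp: C_def G_def)
  interpret cnj: comm_ring_hom cnj
    by unfold_locales auto
  have "Determinant.det C = cnj (Determinant.det B)"
    unfolding C_def using B by (subst det_transpose[of _ n]) (auto simp: cnj.hom_det)
  then have detG: "Determinant.det G = of_real ((cmod (Determinant.det B))\<^sup>2)"
    unfolding G_def by (subst det_mult[OF B C]) (simp only: complex_norm_square)
  have Gij: "G $$ (i, j) = (\<Sum>k<n. B $$ (i, k) * cnj (B $$ (j, k)))" if "i < n" "j < n" for i j
    using that B unfolding G_def C_def
    by (auto simp: scalar_prod_def lessThan_atLeast0 intro!: sum.cong)
  obtain es where es: "char_poly G = (\<Prod>a\<leftarrow>es. [:- a, 1:])"
    using char_poly_factorized[OF G] by auto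
  \<comment> \<open>A triangular form is enough: its diagonal carries the eigenvalues, with the
    trace of \<open>G\<close> as their sum and the determinant as their product.\<close>
  obtain T where T: "T \<in> carrier_mat n n" "upper_triangular T" "similar_mat G T"
    using schur_decomposition_exists[OF G es] by auto
  from similar_matD[OF T(3)] T(1) G obtain P Q where
    PQ: "P \<in> carrier_mat n n" "Q \<in> carrier_mat n n" "Q * P = 1\<^sub>m n" "P * Q = 1\<^sub>m n" "G = P * T * Q"
    by auto
  have trace_comm: "(\<Sum>i<n. (X * Y) $$ (i, i)) = (\<Sum>i<n. (Y * X) $$ (i, i))"
    if "X \<in> carrier_mat n n" "Y \<in> carrier_mat n n" for X Y :: "complex Matrix.mat"
  proof -
    have "(\<Sum>i<n. (X * Y) $$ (i, i)) = (\<Sum>i<n. \<Sum>k<n. X $$ (i, k) * Y $$ (k, i))"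
      using that by (auto simp: scalar_prod_def lessThan_atLeast0 intro!: sum.cong)
    also have "\<dots> = (\<Sum>k<n. \<Sum>i<n. X $$ (i, k) * Y $$ (k, i))"
      by (rule sum.swap)
    also have "\<dots> = (\<Sum>i<n. (Y * X) $$ (i, i))"
      using that by (auto simp: scalar_prod_def lessThan_atLeast0 mult.commute intro!: sum.cong)
    finally show ?thesis .
  qed
  have "(\<Sum>i<n. G $$ (i, i)) = (\<Sum>i<n. (Q * (P * T)) $$ (i, i))"
    unfolding PQ(5) using PQ T by (intro trace_comm) auto
  also have "Q * (P * T) = T"
    using PQ T by (subst assoc_mult_mat[symmetric, of _ n n _ n _ n]) auto
  finally have trG: "(\<Sum>i<n. G $$ (i, i)) = (\<Sum>i<n. T $$ (i, i))" .
  have "Determinant.det G = Determinant.det T"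
    by (rule det_similar[OF T(3)])
  also have "\<dots> = (\<Prod>i<n. T $$ (i, i))"
    using det_upper_triangular[OF T(2,1)] T(1)
    by (simp add: prod_list_diag_prod lessThan_atLeast0)
  finally have detT: "Determinant.det G = (\<Prod>i<n. T $$ (i, i))" .
  have ev: "\<exists>r\<ge>0. T $$ (i, i) = complex_of_real r" if i: "i < n" for i
  proof -
    have "poly (char_poly G) (T $$ (i, i)) = 0"
      unfolding char_poly_similar[OF T(3)] char_poly_upper_triangular[OF T(1,2)]
      using i T(1) by (auto simp: poly_prod_list prod_list_zero_iff diag_mat_def)
    then have "eigenvalue G (T $$ (i, i))"
      using eigenvalue_root_char_poly[OF G] by simp
    then obtain v where v: "v \<in> carrier_vec n" "v \<noteq> 0\<^sub>v n" "G *\<^sub>v v = T $$ (i, i) \<cdot>\<^sub>v v"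
      using G unfolding eigenvalue_def eigenvector_def by auto
    define w where "w k = vec_index v k" for k
    define N where "N = (\<Sum>k<n. (cmod (w k))\<^sup>2)"
    have "\<exists>k<n. w k \<noteq> 0"
      using v(1,2) unfolding w_def by (metis eq_vecI carrier_vecD index_zero_vec)
    then have N: "N > 0"
      unfolding N_def by (auto intro!: sum_pos2)
    have row: "(\<Sum>j<n. G $$ (k, j) * w j) = T $$ (i, i) * w k" if "k < n" for k
    proof -
      have "vec_index (G *\<^sub>v v) k = (\<Sum>j<n. G $$ (k, j) * w j)"
        using that G v(1) by (auto simp: scalar_prod_def lessThan_atLeast0 w_def intro!: sum.cong)
      then show ?thesis using v that by (auto simp: w_def)
    qed
    \<comment> \<open>Rayleigh quotient: \<open>M\<close> is the squared norm of the conjugate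
      transpose of \<open>B\<close> applied to the eigenvector, \<open>N\<close> that of the
      eigenvector itself. The eigenvalue is \<open>M / N\<close>, hence real and
      nonnegative.\<close>
    define M where "M = (\<Sum>l<n. (cmod (\<Sum>k<n. cnj (w k) * B $$ (k, l)))\<^sup>2)"
    have "T $$ (i, i) * of_real N = (\<Sum>k<n. cnj (w k) * (T $$ (i, i) * w k))"
      by (simp add: N_def sum_distrib_left complex_norm_square ac_simps del: of_real_power)
    also have "\<dots> = (\<Sum>k<n. cnj (w k) * (\<Sum>j<n. G $$ (k, j) * w j))"
      using row by (intro sum.cong) auto
    also have "\<dots> = (\<Sum>k<n. \<Sum>j<n. \<Sum>l<n. (cnj (w k) * B $$ (k, l)) * cnj (cnj (w j) * B $$ (j, l)))"
      by (auto simp: Gij sum_distrib_left sum_distrib_right ac_simps intro!: sum.cong)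
    also have "\<dots> = (\<Sum>k<n. \<Sum>l<n. \<Sum>j<n. (cnj (w k) * B $$ (k, l)) * cnj (cnj (w j) * B $$ (j, l)))"
      by (intro sum.cong refl sum.swap)
    also have "\<dots> = (\<Sum>l<n. \<Sum>k<n. \<Sum>j<n. (cnj (w k) * B $$ (k, l)) * cnj (cnj (w j) * B $$ (j, l)))"
      by (rule sum.swap)
    also have "\<dots> = of_real M"
      unfolding M_def of_real_sum complex_norm_square cnj_sum sum_product by simp
    finally have "T $$ (i, i) = of_real (M / N)"
      using N by (simp add: field_simps)
    moreover have "M / N \<ge> 0"
      using N by (simp add: M_def sum_nonneg)
    ultimately show ?thesis by blast
  qed
  then obtain r where r: "\<And>i. i < n \<Longrightarrow> r i \<ge> 0 \<and> T $$ (i, i) = complex_of_real (r i)"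
    by metis
  have det: "(cmod (Determinant.det B))\<^sup>2 = (\<Prod>i<n. r i)"
  proof -
    have "complex_of_real ((cmod (Determinant.det B))\<^sup>2) = of_real (\<Prod>i<n. r i)"
      using detG detT r by simp
    then show ?thesis by (simp only: of_real_eq_iff)
  qed
  have "(\<Sum>i<n. G $$ (i, i)) = of_real (\<Sum>i<n. \<Sum>k<n. (cmod (B $$ (i, k)))\<^sup>2)"
    by (auto simp: Gij complex_norm_square simp del: of_real_power intro!: sum.cong)
  then have "complex_of_real (\<Sum>i<n. r i) = of_real (\<Sum>i<n. \<Sum>k<n. (cmod (B $$ (i, k)))\<^sup>2)"
    using trG r by simp
  then have "(\<Sum>i<n. r i) = (\<Sum>i<n. \<Sum>k<n. (cmod (B $$ (i, k)))\<^sup>2)"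
    by (simp only: of_real_eq_iff)
  also have "\<dots> \<le> (\<Sum>i<n. \<Sum>k<n. 1)"
    by (intro sum_mono) (auto intro: power_le_one le)
  \<comment> \<open>The trace is at most \<open>n * n\<close>, so the mean of the \<open>n\<close>
    eigenvalues is at most \<open>n\<close>; AM-GM then bounds their product by
    \<open>n ^ n\<close>.\<close>
  finally have sum_r: "(\<Sum>i<n. r i / n) \<le> n"
    using False by (simp add: divide_le_eq flip: sum_divide_distrib)
  have nn: "(\<Prod>i<n. r i) \<ge> 0"
    using r by (auto intro: prod_nonneg)
  have "(\<Prod>i<n. r i) powr (1 / n) \<le> (\<Sum>i<n. r i / n)"
    using arith_geom_mean[of "{..<n}" r] r False by auto
  also note sum_r
  finally have "((\<Prod>i<n. r i) powr (1 / n)) ^ n \<le> real n ^ n"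
    by (intro power_mono) auto
  also have "((\<Prod>i<n. r i) powr (1 / n)) ^ n = (\<Prod>i<n. r i)"
    using nn False by (simp add: powr_realpow' powr_powr flip: powr_realpow')
  finally show ?thesis using det by simp
qed

text \<open>Dividing row \<open>i\<close> by \<open>g i\<close> and column \<open>j\<close> by
  \<open>h j\<close> reduces this to entries of modulus at most \<open>1\<close>. The bound is a
  product over the points, so its \<open>n\<close>-fold integral will factorise.\<close>

lemma cmod_det_le_prod:
  fixes k :: "nat \<Rightarrow> nat \<Rightarrow> complex" and g h :: "nat \<Rightarrow> real"
  assumes pos: "\<And>i. i < n \<Longrightarrow> g i > 0" "\<And>i. i < n \<Longrightarrow> h i > 0"
    and le: "\<And>i j. i < n \<Longrightarrow> j < n \<Longrightarrow> cmod (k i j) \<le> g i * h j"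
  shows "cmod (Determinant.det (Matrix.mat n n (\<lambda>(i, j). k i j))) \<le> sqrt (real n ^ n) * (\<Prod>i<n. g i * h i)"
proof -
  define B where "B = Matrix.mat n n (\<lambda>(i, j). k i j / of_real (g i * h j))"
  have B: "B \<in> carrier_mat n n" by (simp add: B_def)
  have "(cmod (Determinant.det B))\<^sup>2 \<le> real n ^ n"
  proof (rule cmod_det_le[OF B])
    fix i j assume ij: "i < n" "j < n"
    then have "g i * h j > 0" using pos by simp
    then show "cmod (B $$ (i, j)) \<le> 1"
      using ij le[OF ij] by (simp add: B_def norm_divide del: of_real_mult)
  qed
  then have detB: "cmod (Determinant.det B) \<le> sqrt (real n ^ n)"
    by (rule real_le_rsqrt)
  have "Determinant.det (Matrix.mat n n (\<lambda>(i, j). k i j))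
      = (\<Sum>p\<in>{p. p permutes {0..<n}}. signof p * (\<Prod>i = 0..<n. k i (p i)))"
    by (subst det_def') (auto intro!: sum.cong prod.cong simp: permutes_in_image
        dest: permutes_in_image[where S="{0..<n}"])
  \<comment> \<open>Every Leibniz term acquires the same factor, because a permutation only reorders
    the product of the values of \<open>h\<close>.\<close>
  also have "\<dots> = (\<Sum>p\<in>{p. p permutes {0..<n}}.
      of_real (\<Prod>i<n. g i * h i) * (signof p * (\<Prod>i = 0..<n. B $$ (i, p i))))"
  proof (rule sum.cong[OF refl])
    fix p assume "p \<in> {p. p permutes {0..<n}}"
    then have p: "p permutes {0..<n}" by simp
    have pn: "p i < n" if "i < n" for i
      using permutes_in_image[OF p, of i] that by simp
    have "(\<Prod>i = 0..<n. k i (p i)) = (\<Prod>i = 0..<n. of_real (g i) * of_real (h (p i)) * B $$ (i, p i))"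
    proof (rule prod.cong[OF refl])
      fix i assume "i \<in> {0..<n}"
      then show "k i (p i) = of_real (g i) * of_real (h (p i)) * B $$ (i, p i)"
        using pn[of i] pos(1)[of i] pos(2)[of "p i"] by (auto simp: B_def)
    qed
    also have "\<dots> = of_real ((\<Prod>i = 0..<n. g i) * (\<Prod>i = 0..<n. h (p i))) * (\<Prod>i = 0..<n. B $$ (i, p i))"
      by (simp add: prod.distrib)
    also have "(\<Prod>i = 0..<n. h (p i)) = (\<Prod>i = 0..<n. h i)"
      using prod.permute[OF p, of h] by (simp add: o_def)
    finally show "signof p * (\<Prod>i = 0..<n. k i (p i))
        = of_real (\<Prod>i<n. g i * h i) * (signof p * (\<Prod>i = 0..<n. B $$ (i, p i)))"
      by (simp add: prod.distrib lessThan_atLeast0)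
  qed
  also have "\<dots> = of_real (\<Prod>i<n. g i * h i) * Determinant.det B"
    by (subst det_def'[OF B]) (simp add: sum_distrib_left)
  finally have eq: "Determinant.det (Matrix.mat n n (\<lambda>(i, j). k i j))
      = of_real (\<Prod>i<n. g i * h i) * Determinant.det B" .
  have "(\<Prod>i<n. g i * h i) \<ge> 0"
    using pos by (intro prod_nonneg) (auto intro: less_imp_le)
  then have "cmod (Determinant.det (Matrix.mat n n (\<lambda>(i, j). k i j)))
      = (\<Prod>i<n. g i * h i) * cmod (Determinant.det B)"
    unfolding eq norm_mult norm_of_real by simp
  also have "\<dots> \<le> (\<Prod>i<n. g i * h i) * sqrt (real n ^ n)"
    using pos detB by (intro mult_left_mono prod_nonneg) (auto intro: less_imp_le)
  finally show ?thesis by (simp add: mult.commute)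
qed

section \<open>Termwise bounds for the Fredholm series\<close>

text \<open>A nonintegrable function has integral \<open>0\<close> by convention, so the usual bound
  extends to it. Kernels and determinants can thus be estimated by pointwise majorants.\<close>

lemma norm_lebesgue_integral_le:
  fixes f :: "'a \<Rightarrow> 'b::{banach, second_countable_topology}"
  assumes "(\<integral>\<^sup>+x. ennreal (norm (f x)) \<partial>M) \<le> ennreal B" "B \<ge> 0"
  shows "norm (integral\<^sup>L M f) \<le> B"
proof (cases "integrable M f")
  case True
  have "ennreal (norm (integral\<^sup>L M f)) \<le> ennreal B"
    using integral_norm_bound_ennreal[OF True] assms(1) by (rule order_trans)
  then show ?thesis using assms(2) by (simp add: ennreal_le_iff)
qed (use assms in \<open>simp add: not_integrable_integral_eq\<close>)

lemma power_div_fact_le_exp: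
  assumes "x \<ge> (0::real)"
  shows "x ^ n / fact n \<le> exp x"
proof -
  have "(\<Sum>k\<in>{n}. inverse (fact k) *\<^sub>R x ^ k) \<le> (\<Sum>k. inverse (fact k) *\<^sub>R x ^ k)"
    using assms by (intro sum_le_suminf summable_exp_generic) auto
  then show ?thesis by (simp add: exp_def divide_inverse mult.commute)
qed

text \<open>In the square of the left side, \<open>n ^ n / n!\<close> is at most
  \<open>4 ^ n\<close>; writing this as \<open>(1/4) ^ n * 16 ^ n\<close> moves
  \<open>16 ^ n\<close> into a term of the series of \<open>exp (16 * m\<^sup>2)\<close>. The
  geometric factor left over makes the Fredholm series summable.\<close>

lemma hadamard_term_le:
  assumes "m \<ge> (0::real)"
  shows "sqrt (real n ^ n) / fact n * m ^ n \<le> (1 / 2) ^ n * exp (8 * m\<^sup>2)"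
proof -
  have e4: "exp (real n) \<le> 4 ^ n"
  proof -
    have "exp (real n) = exp 1 ^ n" using exp_of_nat_mult[of n "1::real"] by simp
    also have "\<dots> \<le> 4 ^ n" using exp_le by (intro power_mono) auto
    finally show ?thesis .
  qed
  have "(sqrt (real n ^ n) / fact n * m ^ n)\<^sup>2 = (real n ^ n / fact n) * ((m\<^sup>2) ^ n / fact n)"
    by (simp add: power2_eq_square power_mult_distrib field_simps)
  also have "\<dots> \<le> exp (real n) * ((m\<^sup>2) ^ n / fact n)"
    by (intro mult_right_mono power_div_fact_le_exp) auto
  also have "\<dots> \<le> 4 ^ n * ((m\<^sup>2) ^ n / fact n)"
    using e4 by (intro mult_right_mono) auto
  also have "4 ^ n * ((m\<^sup>2) ^ n / fact n) = (1/4) ^ n * ((16 * m\<^sup>2) ^ n / fact n)"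
  proof -
    have "(16 * m\<^sup>2) ^ n = 16 ^ n * (m\<^sup>2) ^ n" by (rule power_mult_distrib)
    moreover have "(16::real) ^ n = 4 ^ n * 4 ^ n" by (simp flip: power_mult_distrib)
    ultimately show ?thesis by (simp add: power_divide)
  qed
  also have "\<dots> \<le> (1/4) ^ n * exp (16 * m\<^sup>2)"
    by (intro mult_left_mono power_div_fact_le_exp) auto
  also have "\<dots> = ((1 / 2) ^ n * exp (8 * m\<^sup>2))\<^sup>2"
  proof -
    have "(1/4::real) ^ n = (1/2) ^ n * (1/2) ^ n" by (simp flip: power_mult_distrib)
    moreover have "exp (16 * m\<^sup>2) = exp (8 * m\<^sup>2) * exp (8 * m\<^sup>2)" by (simp flip: exp_add)
    ultimately show ?thesis by (simp only: power2_eq_square mult_ac)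
  qed
  finally show ?thesis
    by (rule power2_le_imp_le) auto
qed

text \<open>The bound is linear in \<open>E\<close>, the small parameter; \<open>A\<close> may be large.\<close>
lemma norm_fredholm_det_minus_1_le:
  fixes M :: "'a measure" and k :: "'a \<Rightarrow> 'a \<Rightarrow> complex" and g h :: "'a \<Rightarrow> real"
  assumes M: "sigma_finite_measure M"
    and pos: "\<And>x. x \<in> space M \<Longrightarrow> g x > 0" "\<And>x. x \<in> space M \<Longrightarrow> h x > 0"
    and le: "\<And>x y. x \<in> space M \<Longrightarrow> y \<in> space M \<Longrightarrow> cmod (k x y) \<le> g x * h y"
    and meas: "(\<lambda>x. g x * h x) \<in> borel_measurable M"
    and int: "(\<integral>\<^sup>+x. ennreal (g x * h x) \<partial>M) \<le> ennreal (A * E)"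
    and AE: "A \<ge> 0" "0 \<le> E" "E \<le> 1"
  shows "cmod (fredholm_det M k - 1) \<le> E * exp (8 * A\<^sup>2)"
proof -
  define c where "c n = (-1) ^ n / fact n *
        (LINT x|PiM {..<n} (\<lambda>_. M). Determinant.det (Matrix.mat n n (\<lambda>(i, j). k (x i) (x j))))" for n
  interpret product_sigma_finite "\<lambda>_::nat. M"
    using M by (simp add: product_sigma_finite_def)
  have I: "cmod (LINT x|PiM {..<n} (\<lambda>_. M). Determinant.det (Matrix.mat n n (\<lambda>(i, j). k (x i) (x j))))
      \<le> sqrt (real n ^ n) * (A * E) ^ n" for n
  proof (rule norm_lebesgue_integral_le)
    have "(\<integral>\<^sup>+x. ennreal (cmod (Determinant.det (Matrix.mat n n (\<lambda>(i, j). k (x i) (x j))))) \<partial>PiM {..<n} (\<lambda>_. M))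
      \<le> (\<integral>\<^sup>+x. ennreal (sqrt (real n ^ n)) * (\<Prod>i<n. ennreal (g (x i) * h (x i))) \<partial>PiM {..<n} (\<lambda>_. M))"
    proof (rule nn_integral_mono)
      fix x assume "x \<in> space (PiM {..<n} (\<lambda>_. M))"
      then have x: "x i \<in> space M" if "i < n" for i
        using that by (auto simp: space_PiM)
      have "cmod (Determinant.det (Matrix.mat n n (\<lambda>(i, j). k (x i) (x j))))
        \<le> sqrt (real n ^ n) * (\<Prod>i<n. g (x i) * h (x i))"
        using x pos le by (intro cmod_det_le_prod) auto
      then have "ennreal (cmod (Determinant.det (Matrix.mat n n (\<lambda>(i, j). k (x i) (x j)))))
        \<le> ennreal (sqrt (real n ^ n) * (\<Prod>i<n. g (x i) * h (x i)))"
        by (rule ennreal_leI)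
      also have "\<dots> = ennreal (sqrt (real n ^ n)) * (\<Prod>i<n. ennreal (g (x i) * h (x i)))"
      proof -
        have *: "g (x i) * h (x i) \<ge> 0" if "i < n" for i
          using x[OF that] pos by (auto intro!: mult_nonneg_nonneg intro: less_imp_le)
        have nn: "0 \<le> (\<Prod>i<n. g (x i) * h (x i))"
          by (rule prod_nonneg) (use * in auto)
        have "(\<Prod>i<n. ennreal (g (x i) * h (x i))) = ennreal (\<Prod>i<n. g (x i) * h (x i))"
          by (rule prod_ennreal) (use * in auto)
        then show ?thesis
          using ennreal_mult[OF _ nn, of "sqrt (real n ^ n)"] by simp
      qed
      finally show "ennreal (cmod (Determinant.det (Matrix.mat n n (\<lambda>(i, j). k (x i) (x j)))))
        \<le> ennreal (sqrt (real n ^ n)) * (\<Prod>i<n. ennreal (g (x i) * h (x i)))" .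
    qed
    also have "\<dots> = ennreal (sqrt (real n ^ n)) * (\<integral>\<^sup>+x. (\<Prod>i<n. ennreal (g (x i) * h (x i))) \<partial>PiM {..<n} (\<lambda>_. M))"
      using meas by (intro nn_integral_cmult) auto
    also have "(\<integral>\<^sup>+x. (\<Prod>i<n. ennreal (g (x i) * h (x i))) \<partial>PiM {..<n} (\<lambda>_. M))
        = (\<Prod>i<n. (\<integral>\<^sup>+x. ennreal (g x * h x) \<partial>M))"
      using meas by (intro product_nn_integral_prod) auto
    also have "ennreal (sqrt (real n ^ n)) * \<dots> \<le> ennreal (sqrt (real n ^ n)) * (\<Prod>i<n. ennreal (A * E))"
      using int by (intro mult_left_mono prod_mono_ennreal) auto
    also have "\<dots> = ennreal (sqrt (real n ^ n) * (A * E) ^ n)"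
    proof -
      have "A * E \<ge> 0" using AE by simp
      then show ?thesis
        unfolding prod_constant card_lessThan
        by (subst ennreal_power) (auto intro: ennreal_mult[symmetric])
    qed
    finally show "(\<integral>\<^sup>+x. ennreal (cmod (Determinant.det (Matrix.mat n n (\<lambda>(i, j). k (x i) (x j))))) \<partial>PiM {..<n} (\<lambda>_. M))
      \<le> ennreal (sqrt (real n ^ n) * (A * E) ^ n)" .
  qed (use AE in auto)
  \<comment> \<open>The term \<open>n = 0\<close> is the determinant of the empty matrix, integrated
    over a one-point space; it is the \<open>1\<close> that gets subtracted.\<close>
  have c0: "c 0 = 1"
    by (simp add: c_def PiM_empty)
  have cS: "cmod (c (Suc n)) \<le> E * exp (8 * A\<^sup>2) * (1 / 2) ^ Suc n" for n
  proof -
    have "cmod (c (Suc n)) \<le> sqrt (real (Suc n) ^ Suc n) * (A * E) ^ Suc n / fact (Suc n)"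
      using I[of "Suc n"] by (simp add: c_def norm_mult norm_divide norm_power divide_right_mono del: power_Suc fact_Suc of_nat_Suc)
    also have "\<dots> = (sqrt (real (Suc n) ^ Suc n) / fact (Suc n) * A ^ Suc n) * E ^ Suc n"
      by (simp only: power_mult_distrib) (simp add: field_simps)
    \<comment> \<open>All powers of \<open>A\<close> go into the exponential, while
      \<open>E \<le> 1\<close> allows all but one power of \<open>E\<close> to be dropped; this
      gives linearity in \<open>E\<close>.\<close>
    also have "\<dots> \<le> ((1 / 2) ^ Suc n * exp (8 * A\<^sup>2)) * E ^ 1"
      using AE by (intro mult_mono hadamard_term_le power_decreasing) auto
    finally show ?thesis by (simp add: mult_ac)
  qed
  have s: "(\<lambda>n. E * exp (8 * A\<^sup>2) * (1 / 2) ^ Suc n) sums (E * exp (8 * A\<^sup>2))"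
    using sums_mult[OF power_half_series, of "E * exp (8 * A\<^sup>2)"] by simp
  have sc: "summable (\<lambda>n. c (Suc n))"
    using cS by (intro summable_comparison_test[OF _ sums_summable[OF s]]) blast
  have "fredholm_det M k = suminf c"
    by (simp add: fredholm_det_def c_def[abs_def])
  also have "\<dots> = (\<Sum>n. c (Suc n)) + c 0"
    using sc by (subst suminf_split_head) (simp_all add: summable_Suc_iff)
  finally have "cmod (fredholm_det M k - 1) = cmod (\<Sum>n. c (Suc n))"
    by (simp add: c0)
  also have "\<dots> \<le> (\<Sum>n. E * exp (8 * A\<^sup>2) * (1 / 2) ^ Suc n)"
    using cS by (intro norm_suminf_le sums_summable[OF s]) auto
  also have "\<dots> = E * exp (8 * A\<^sup>2)"
    using sums_unique[OF s] by simp
  finally show ?thesis .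
qed

subsection \<open>The Gamma function on vertical lines\<close>

text \<open>\<open>1 + y\<^sup>2/(x + k)\<^sup>2\<close> decreases in \<open>x\<close>, factor by factor in the product for \<open>1/\<Gamma>\<close>.\<close>
lemma cmod_rGamma_le:
  assumes "x \<ge> 0"
  shows "cmod (rGamma (Complex (1 + x) y)) \<le> rGamma (1 + x) * cmod (rGamma (Complex 1 y))"
proof -
  have *: "cmod (rGamma_series (Complex (1 + x) y) n) \<le> rGamma_series (1 + x) n * cmod (rGamma_series (Complex 1 y) n)"
    if n: "n > 0" for n
  proof -
    have fac: "cmod (Complex (1 + x) y + of_nat k) \<le> (1 + x + real k) * cmod (Complex 1 y + of_nat k) / (1 + real k)" for k
    proof -
      have e: "Complex (1 + x) y + of_nat k = Complex (1 + x + k) y" "Complex 1 y + of_nat k = Complex (1 + real k) y"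
        by (simp_all add: complex_eq_iff)
      have "(cmod (Complex (1 + x + k) y) * (1 + real k))\<^sup>2 \<le> ((1 + x + k) * cmod (Complex (1 + real k) y))\<^sup>2"
      proof -
        have "y\<^sup>2 * (1 + real k)\<^sup>2 \<le> y\<^sup>2 * (1 + x + k)\<^sup>2"
          using assms by (intro mult_left_mono power_mono) auto
        then show ?thesis
          unfolding power_mult_distrib cmod_power2 complex.sel by (simp only: algebra_simps)
      qed
      then have "cmod (Complex (1 + x + k) y) * (1 + real k) \<le> (1 + x + k) * cmod (Complex (1 + real k) y)"
        by (rule power2_le_imp_le) (use assms in auto)
      then show ?thesis unfolding e by (simp add: field_simps)
    qed
    have "cmod (pochhammer (Complex (1 + x) y) (n + 1)) = (\<Prod>k\<le>n. cmod (Complex (1 + x) y + of_nat k))"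
      by (simp add: pochhammer_prod prod_norm lessThan_Suc_atMost atLeast0LessThan del: prod.lessThan_Suc)
    also have "\<dots> \<le> (\<Prod>k\<le>n. (1 + x + real k) * cmod (Complex 1 y + of_nat k) / (1 + real k))"
      using fac by (intro prod_mono) auto
    also have "\<dots> = (\<Prod>k\<le>n. (1 + x + real k)) * (\<Prod>k\<le>n. cmod (Complex 1 y + of_nat k)) / (\<Prod>k\<le>n. 1 + real k)"
      by (simp only: prod.distrib prod_dividef)
    also have "(\<Prod>k\<le>n. (1 + x + real k)) = pochhammer (1 + x) (n + 1)"
      by (simp add: pochhammer_prod lessThan_Suc_atMost atLeast0LessThan del: prod.lessThan_Suc)
    also have "(\<Prod>k\<le>n. cmod (Complex 1 y + of_nat k)) = cmod (pochhammer (Complex 1 y) (n + 1))"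
      by (simp add: pochhammer_prod prod_norm lessThan_Suc_atMost atLeast0LessThan del: prod.lessThan_Suc)
    also have "(\<Prod>k\<le>n. 1 + real k) = fact (n + 1)"
      by (simp add: fact_prod_Suc lessThan_Suc_atMost atLeast0LessThan del: prod.lessThan_Suc prod.atMost_Suc)
    finally have P: "cmod (pochhammer (Complex (1 + x) y) (n + 1))
      \<le> pochhammer (1 + x) (n + 1) * cmod (pochhammer (Complex 1 y) (n + 1)) / fact (n + 1)" .
    have ex: "cmod (exp (Complex u y * of_real (ln (real n)))) = exp (u * ln (real n))" for u
      by simp
    have "cmod (rGamma_series (Complex (1 + x) y) n)
        = cmod (pochhammer (Complex (1 + x) y) (n + 1)) / (fact n * exp ((1 + x) * ln (real n)))"
      unfolding rGamma_series_def by (simp only: norm_divide norm_mult norm_fact ex)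
    also have "\<dots> \<le> (pochhammer (1 + x) (n + 1) * cmod (pochhammer (Complex 1 y) (n + 1)) / fact (n + 1))
        / (fact n * exp ((1 + x) * ln (real n)))"
      by (intro divide_right_mono P) auto
    also have "\<dots> = rGamma_series (1 + x) n * (cmod (pochhammer (Complex 1 y) (n + 1)) / fact (n + 1))"
      unfolding rGamma_series_def by simp
    also have "\<dots> \<le> rGamma_series (1 + x) n * cmod (rGamma_series (Complex 1 y) n)"
    proof (rule mult_left_mono)
      show "rGamma_series (1 + x) n \<ge> 0"
        using assms unfolding rGamma_series_def
        by (intro divide_nonneg_nonneg pochhammer_nonneg mult_nonneg_nonneg) auto
      show "cmod (pochhammer (Complex 1 y) (n + 1)) / fact (n + 1) \<le> cmod (rGamma_series (Complex 1 y) n)"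
    proof -
      \<comment> \<open>The products have \<open>n + 1\<close> factors and were normalised by
        \<open>(n + 1)!\<close>, whereas \<open>rGamma_series\<close> on the line through
        \<open>1\<close> divides by \<open>n! * n\<close>, which is smaller.\<close>
      have "fact n * exp (1 * ln (real n)) \<le> (fact (n + 1) :: real)"
        using n by (simp add: algebra_simps)
      then have "cmod (pochhammer (Complex 1 y) (n + 1)) / fact (n + 1)
        \<le> cmod (pochhammer (Complex 1 y) (n + 1)) / (fact n * exp (1 * ln (real n)))"
        by (intro divide_left_mono) auto
      then show ?thesis
        unfolding rGamma_series_def by (simp only: norm_divide norm_mult norm_fact ex)
      qed
    qed
    finally show ?thesis .
  qed
  show ?thesis
  proof (rule tendsto_le)
    show "(\<lambda>n. rGamma_series (1 + x) n * cmod (rGamma_series (Complex 1 y) n)) \<longlonglongrightarrow> rGamma (1 + x) * cmod (rGamma (Complex 1 y))"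
      by (intro tendsto_intros)
    show "(\<lambda>n. cmod (rGamma_series (Complex (1 + x) y) n)) \<longlonglongrightarrow> cmod (rGamma (Complex (1 + x) y))"
      by (intro tendsto_intros)
    show "\<forall>\<^sub>F n in sequentially. cmod (rGamma_series (Complex (1 + x) y) n) \<le> rGamma_series (1 + x) n * cmod (rGamma_series (Complex 1 y) n)"
      using * by (intro eventually_mono[OF eventually_gt_at_top[of 0]]) blast
  qed simp
qed

text \<open>The sine becomes a hyperbolic sine. The factor \<open>\<bar>y\<bar>\<close> is kept
  because it cancels in the reflection formula.\<close>

lemma cmod_sin_imaginary_le: "cmod (sin (of_real y * \<i>)) \<le> \<bar>y\<bar> * exp \<bar>y\<bar>"
proof -
  have "sin (of_real y * \<i>) = \<i> * of_real ((exp y - exp (- y)) / 2)"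
    using sin_i_times[of "of_real y"] by (simp add: mult.commute exp_of_real[symmetric] exp_minus)
  then have "cmod (sin (of_real y * \<i>)) = \<bar>exp y - exp (- y)\<bar> / 2"
    by (simp only: norm_mult norm_ii norm_of_real) simp
  also have "\<bar>exp y - exp (- y)\<bar> = exp \<bar>y\<bar> - exp (- \<bar>y\<bar>)"
    by (cases "y \<ge> 0") auto
  also have "\<dots> = exp \<bar>y\<bar> * (1 - exp (- (2 * \<bar>y\<bar>)))"
    by (simp add: algebra_simps flip: exp_add)
  also have "\<dots> \<le> exp \<bar>y\<bar> * (2 * \<bar>y\<bar>)"
    using exp_ge_add_one_self[of "- (2 * \<bar>y\<bar>)"] by (intro mult_left_mono) auto
  finally show ?thesis by (simp add: mult.commute)
qed

text \<open>Reflection formula at \<open>\<i> * y\<close>: the two Gamma factors are taken at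
  conjugate points, so their product is a squared modulus, equal to
  \<open>sinh (pi * y) / (pi * y)\<close>.\<close>

lemma cmod_rGamma_Complex_1_le: "cmod (rGamma (Complex 1 y)) \<le> exp (pi * \<bar>y\<bar> / 2)"
proof (cases "y = 0")
  case True
  then show ?thesis by (simp flip: one_complex.code)
next
  case False
  define z where "z = Complex 0 y"
  have z: "z = of_real y * \<i>" by (simp add: z_def complex_eq_iff)
  have "z * rGamma (1 + z) = rGamma z"
    using rGamma_plus1[of z] by (simp add: add.commute)
  moreover have "1 + z = Complex 1 y" "1 - z = cnj (Complex 1 y)"
    by (simp_all add: z_def complex_eq_iff)
  ultimately have "z * (rGamma (Complex 1 y) * cnj (rGamma (Complex 1 y))) = sin (of_real pi * z) / of_real pi"
    using rGamma_reflection_complex[of z] unfolding mult.assoc[symmetric] cnj_rGamma by simp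
  then have "cmod (z * (rGamma (Complex 1 y) * cnj (rGamma (Complex 1 y)))) = cmod (sin (of_real pi * z) / of_real pi)"
    by simp
  then have "\<bar>y\<bar> * (cmod (rGamma (Complex 1 y)))\<^sup>2 = cmod (sin (of_real (pi * y) * \<i>)) / pi"
    by (simp add: z norm_mult norm_divide power2_eq_square mult_ac)
  also have "\<dots> \<le> \<bar>pi * y\<bar> * exp \<bar>pi * y\<bar> / pi"
    by (intro divide_right_mono cmod_sin_imaginary_le) auto
  also have "\<dots> = \<bar>y\<bar> * exp (pi * \<bar>y\<bar>)"
    by (simp add: abs_mult)
  finally have "(cmod (rGamma (Complex 1 y)))\<^sup>2 \<le> exp (pi * \<bar>y\<bar>)"
    using False by simp
  also have "\<dots> = (exp (pi * \<bar>y\<bar> / 2))\<^sup>2"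
    by (simp add: power2_eq_square flip: exp_add)
  finally show ?thesis by (rule power2_le_imp_le) simp
qed

lemma continuous_on_compact_bounded:
  fixes f :: "'a::topological_space \<Rightarrow> 'b::real_normed_vector"
  assumes "compact S" "continuous_on S f"
  obtains C where "C > 0" "\<And>x. x \<in> S \<Longrightarrow> norm (f x) \<le> C"
proof -
  have "bounded (f ` S)"
    using assms by (intro compact_imp_bounded compact_continuous_image)
  then show ?thesis
    unfolding bounded_pos using that by auto
qed

text \<open>Compactness settles \<open>[0, 1]\<close>. Beyond it,
  \<open>rGamma (1 + x) = rGamma x / x\<close> is at most \<open>rGamma x\<close>, so unit steps to
  the right never increase the bound.\<close>

lemma rGamma_1_plus_bounded:
  obtains C :: real where "C > 0" "\<And>x. x \<ge> 0 \<Longrightarrow> rGamma (1 + x) \<le> C"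
proof -
  obtain C where C: "C > 0" "\<And>x. x \<in> {0..1} \<Longrightarrow> norm (rGamma (1 + x :: real)) \<le> C"
    by (rule continuous_on_compact_bounded[of "{0..1::real}" "\<lambda>x. rGamma (1 + x)"])
      (auto intro!: continuous_on_compose2[OF continuous_on_rGamma[of UNIV]] continuous_intros)
  have *: "rGamma (1 + x) \<le> C" if "0 \<le> x" "x \<le> real (Suc n)" for n and x :: real
    using that
  proof (induction n arbitrary: x)
    case 0
    then show ?case using C(2)[of x] by auto
  next
    case (Suc n)
    show ?case
    proof (cases "x \<le> 1")
      case True
      then show ?thesis using C(2)[of x] Suc.prems by fastforce
    next
      case False
      then have "rGamma (1 + (x - 1)) \<le> C"
        using Suc.prems by (intro Suc.IH) auto
      moreover have "x * rGamma (x + 1) = rGamma x" by (rule rGamma_plus1)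
      moreover have "1 * rGamma (x + 1) \<le> x * rGamma (x + 1)"
        using False by (intro mult_right_mono) (auto simp: rGamma_inverse_Gamma intro!: less_imp_le)
      ultimately show ?thesis by (simp add: add.commute)
    qed
  qed
  have "rGamma (1 + x) \<le> C" if "0 \<le> x" for x
  proof -
    obtain n where "x \<le> real n" using real_arch_simple by blast
    then show ?thesis using *[of x n] that by simp
  qed
  then show ?thesis using that[OF C(1)] by blast
qed

section \<open>Bounds for Gamma itself, away from its poles\<close>

text \<open>In Euler's limit formula each factor \<open>z + k\<close> of the denominator has modulus
  at least \<open>Re z + k\<close>.\<close>

lemma cmod_Gamma_le_Gamma_Re:
  assumes "Re z > 0"
  shows "cmod (Gamma z) \<le> Gamma (Re z)"
proof (rule tendsto_le)
  show "Gamma_series (Re z) \<longlonglongrightarrow> Gamma (Re z)"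
    by (rule Gamma_series_LIMSEQ)
  show "(\<lambda>n. cmod (Gamma_series z n)) \<longlonglongrightarrow> cmod (Gamma z)"
    by (intro tendsto_intros)
  have "cmod (Gamma_series z n) \<le> Gamma_series (Re z) n" for n
  proof -
    have "cmod (Gamma_series z n) = fact n * exp (Re z * ln (real n)) / (\<Prod>k<n + 1. cmod (z + of_nat k))"
      unfolding Gamma_series_def
      by (simp add: norm_divide norm_mult pochhammer_prod prod_norm atLeast0LessThan del: prod.lessThan_Suc)
    also have "\<dots> \<le> fact n * exp (Re z * ln (real n)) / (\<Prod>k<n + 1. Re z + real k)"
    proof (intro divide_left_mono prod_mono conjI mult_pos_pos prod_pos)
      show "Re z + real k \<le> cmod (z + of_nat k)" for k
        using complex_Re_le_cmod[of "z + of_nat k"] by simp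
      then show "0 < cmod (z + of_nat k)" for k
        using assms by (meson add_pos_nonneg less_le_trans of_nat_0_le_iff)
    qed (use assms in \<open>auto intro: add_nonneg_nonneg add_pos_nonneg\<close>)
    also have "\<dots> = Gamma_series (Re z) n"
      unfolding Gamma_series_def by (simp add: pochhammer_prod atLeast0LessThan del: prod.lessThan_Suc)
    finally show ?thesis .
  qed
  then show "\<forall>\<^sub>F n in sequentially. cmod (Gamma_series z n) \<le> Gamma_series (Re z) n"
    by simp
qed simp

lemma Gamma_bounded_Icc:
  fixes a b :: real
  assumes "a > 0"
  obtains C where "C > 0" "\<And>x. x \<in> {a..b} \<Longrightarrow> Gamma x \<le> C"
proof -
  obtain C where C: "C > 0" "\<And>x. x \<in> {a..b} \<Longrightarrow> norm (Gamma x) \<le> C"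
    by (rule continuous_on_compact_bounded[of "{a..b}" Gamma])
      (use assms in \<open>auto intro!: continuous_on_Gamma elim!: nonpos_Ints_cases\<close>)
  then show ?thesis using that[of C] by (metis abs_ge_self order_trans real_norm_def)
qed

text \<open>For real part between \<open>1\<close> and \<open>2\<close> the real Gamma function is a
  majorant. Each step to the left divides by \<open>z\<close>, of modulus at least
  \<open>\<bar>Im z\<bar> \<ge> 1\<close>, so the same constant persists.\<close>

lemma cmod_Gamma_bounded_strip:
  obtains C where "C > 0" "\<And>z. \<bar>Im z\<bar> \<ge> 1 \<Longrightarrow> Re z \<le> 2 \<Longrightarrow> cmod (Gamma z) \<le> C"
proof -
  obtain C where C: "C > 0" "\<And>x. x \<in> {1..2} \<Longrightarrow> Gamma x \<le> (C::real)"
    using Gamma_bounded_Icc[of 1 2] by auto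
  have *: "cmod (Gamma z) \<le> C" if "\<bar>Im z\<bar> \<ge> 1" "Re z \<le> 2" "Re z \<ge> 1 - real n" for z n
    using that
  proof (induction n arbitrary: z)
    case 0
    then show ?case
      using cmod_Gamma_le_Gamma_Re[of z] C(2)[of "Re z"] by auto
  next
    case (Suc n)
    show ?case
    proof (cases "Re z \<ge> 1")
      case True
      then show ?thesis
        using Suc.prems cmod_Gamma_le_Gamma_Re[of z] C(2)[of "Re z"] by auto
    next
      case False
      have "z \<notin> \<int>\<^sub>\<le>\<^sub>0" using Suc.prems by (auto elim!: nonpos_Ints_cases)
      then have "cmod z * cmod (Gamma z) = cmod (Gamma (z + 1))"
        by (simp add: Gamma_plus1 norm_mult)
      also have "\<dots> \<le> C" using Suc False by auto
      finally have "cmod z * cmod (Gamma z) \<le> C" .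
      moreover have "1 * cmod (Gamma z) \<le> cmod z * cmod (Gamma z)"
        using Suc.prems abs_Im_le_cmod[of z] by (intro mult_right_mono) auto
      ultimately show ?thesis by simp
    qed
  qed
  have "cmod (Gamma z) \<le> C" if "\<bar>Im z\<bar> \<ge> 1" "Re z \<le> 2" for z
  proof -
    obtain n where "1 - Re z \<le> real n" using real_arch_simple by blast
    then show ?thesis using *[of z n] that by linarith
  qed
  then show ?thesis using that C by blast
qed

subsection \<open>The deformed Airy functions\<close>

text \<open>Expressing an improper integral by a primitive turns contour deformation into a
  comparison of values of \<open>F\<close> at far points. The bound on \<open>f\<close> gives
  integrability, hence convergence of the truncated integrals.\<close>

lemma ray_integral_tendsto_primitive:
  assumes S: "open S" "\<And>r. r \<ge> 0 \<Longrightarrow> p + of_real r * w \<in> S"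
    and F: "\<And>z. z \<in> S \<Longrightarrow> (F has_field_derivative f z) (at z)"
    and f: "continuous_on S f"
    and bd: "eventually (\<lambda>r. cmod (f (p + of_real r * w)) \<le> C * inverse (1 + r\<^sup>2)) at_top"
  shows "((\<lambda>r. F (p + of_real r * w) - F p) \<longlongrightarrow> ray_integral p w f) at_top"
proof -
  define g where "g r = f (p + of_real r * w) * w" for r
  have cont: "continuous_on {0..} g"
    unfolding g_def using S(2)
    by (intro continuous_intros continuous_on_compose2[OF f]) auto
  from bd obtain R0 where R0: "\<And>r. r \<ge> R0 \<Longrightarrow> cmod (f (p + of_real r * w)) \<le> C * inverse (1 + r\<^sup>2)"
    unfolding eventually_at_top_linorder by blast
  define R where "R = max 0 R0"
  have R: "R \<ge> 0" "\<And>r. r \<ge> R \<Longrightarrow> cmod (f (p + of_real r * w)) \<le> C * inverse (1 + r\<^sup>2)"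
    using R0 by (auto simp: R_def)
  have "continuous_on {0..R} g"
    by (rule continuous_on_subset[OF cont]) auto
  then obtain D where D: "D > 0" "\<And>r. r \<in> {0..R} \<Longrightarrow> norm (g r) \<le> D"
    using continuous_on_compact_bounded[of "{0..R}" g] by blast
  \<comment> \<open>\<open>E\<close> extends the eventual bound to the whole ray: its first summand
    covers the compact piece up to \<open>R\<close>, its second the rest.\<close>
  define E where "E = D * (1 + R\<^sup>2) + \<bar>C\<bar> * cmod w"
  have gE: "norm (g r) \<le> norm (E * inverse (1 + r\<^sup>2))" if "r \<ge> 0" for r
  proof -
    have E0: "E \<ge> 0" using D by (simp add: E_def)
    have pos: "1 + r\<^sup>2 > 0" by (simp add: add_pos_nonneg)
    have "norm (g r) \<le> E * inverse (1 + r\<^sup>2)"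
    proof (cases "r \<le> R")
      case True
      have "norm (g r) * (1 + r\<^sup>2) \<le> D * (1 + R\<^sup>2)"
        using D(2)[of r] True that D(1) by (intro mult_mono add_left_mono power_mono) auto
      also have "\<dots> \<le> E" by (simp add: E_def)
      finally show ?thesis using pos by (simp add: field_simps)
    next
      case False
      have "norm (g r) \<le> C * inverse (1 + r\<^sup>2) * cmod w"
        unfolding g_def norm_mult using R(2)[of r] False by (intro mult_right_mono) auto
      also have "\<dots> \<le> \<bar>C\<bar> * inverse (1 + r\<^sup>2) * cmod w"
        using pos by (intro mult_right_mono) auto
      also have "\<dots> = (\<bar>C\<bar> * cmod w) * inverse (1 + r\<^sup>2)"
        by (simp only: mult_ac)
      also have "\<dots> \<le> E * inverse (1 + r\<^sup>2)"
        using D pos by (intro mult_right_mono) (auto simp: E_def)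
      finally show ?thesis .
    qed
    then show ?thesis using E0 pos by simp
  qed
  have "set_integrable lborel {0..} (\<lambda>r::real. E * inverse (1 + r\<^sup>2))"
    using integrable_inverse_1_plus_square
    by (intro set_integrable_mult_right) (rule set_integrable_subset, auto)
  moreover have "set_borel_measurable lborel {0..} g"
    using borel_measurable_continuous_on_indicator[OF _ cont] by (simp add: set_borel_measurable_def)
  ultimately have int: "set_integrable lborel {0..} g"
    by (rule set_integrable_bound) (use gE in auto)
  have "((\<lambda>b. set_lebesgue_integral lborel {0..b} g) \<longlongrightarrow> set_lebesgue_integral lborel {0..} g) at_top"
    by (rule tendsto_set_lebesgue_integral_at_top[OF _ int]) auto
  moreover have "set_lebesgue_integral lborel {0..b} g = F (p + of_real b * w) - F p" if "b \<ge> 0" for b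
  proof -
    have "((\<lambda>r. F (p + of_real r * w)) has_vector_derivative g r) (at r within {0..b})"
      if "0 \<le> r" "r \<le> b" for r
    proof -
      have "((\<lambda>r. p + of_real r * w) has_vector_derivative w) (at r within {0..b})"
        by (auto intro!: derivative_eq_intros)
      moreover have "(F has_field_derivative f (p + of_real r * w)) (at (p + of_real r * w))"
        using F S(2) that by auto
      ultimately have "((F \<circ> (\<lambda>r. p + of_real r * w)) has_vector_derivative w * f (p + of_real r * w)) (at r within {0..b})"
        by (rule field_vector_diff_chain_within[OF _ has_field_derivative_at_within])
      then show ?thesis by (simp add: o_def g_def mult.commute)
    qed
    then have "(\<integral>x. indicator {0..b} x *\<^sub>R g x \<partial>lborel) = F (p + of_real b * w) - F (p + of_real 0 * w)"
      using that by (intro integral_FTC_Icc continuous_on_subset[OF cont]) auto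
    then show ?thesis by (simp add: set_lebesgue_integral_def)
  qed
  then have "eventually (\<lambda>b. set_lebesgue_integral lborel {0..b} g = F (p + of_real b * w) - F p) at_top"
    by (intro eventually_mono[OF eventually_ge_at_top[of 0]]) auto
  moreover have "ray_integral p w f = set_lebesgue_integral lborel {0..} g"
    unfolding ray_integral_def g_def[abs_def] ..
  ultimately show ?thesis
    by (simp add: filterlim_cong)
qed

text \<open>Mean value inequality against \<open>B * arctan\<close>, whose oscillation over the
  whole line is \<open>B * pi\<close>; the bound is therefore independent of the length of the
  segment.\<close>

lemma vertical_increment_le:
  assumes F: "\<And>v. v1 \<le> v \<Longrightarrow> v \<le> v2 \<Longrightarrow> (F has_field_derivative f (Complex u v)) (at (Complex u v))"
    and bd: "\<And>v. v1 \<le> v \<Longrightarrow> v \<le> v2 \<Longrightarrow> cmod (f (Complex u v)) \<le> B * inverse (1 + v\<^sup>2)"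
    and "v1 \<le> v2" "B \<ge> 0"
  shows "cmod (F (Complex u v2) - F (Complex u v1)) \<le> B * pi"
proof (cases "v1 = v2")
  case False
  have line: "Complex u = (\<lambda>v. of_real u + of_real v * \<i>)"
    by (auto simp: complex_eq_iff)
  have d: "((\<lambda>v. F (Complex u v)) has_vector_derivative \<i> * f (Complex u v)) (at v)"
    if "v1 \<le> v" "v \<le> v2" for v
  proof -
    have "(Complex u has_vector_derivative \<i>) (at v)"
      unfolding line by (auto intro!: derivative_eq_intros)
    from field_vector_diff_chain_at[OF this F[OF that]] show ?thesis
      by (simp add: o_def)
  qed
  have "norm (F (Complex u v2) - F (Complex u v1)) \<le> B * arctan v2 - B * arctan v1"
  proof (rule differentiable_bound_general[where f' = "\<lambda>v. \<i> * f (Complex u v)"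
        and \<phi>' = "\<lambda>v. B * inverse (1 + v\<^sup>2)"])
    show "v1 < v2" using False assms by simp
    show "continuous_on {v1..v2} (\<lambda>v. F (Complex u v))"
      using has_vector_derivative_continuous[OF d] by (intro continuous_at_imp_continuous_on) auto
    show "continuous_on {v1..v2} (\<lambda>v. B * arctan v)"
      by (intro continuous_intros)
    show "((\<lambda>v. B * arctan v) has_vector_derivative B * inverse (1 + v\<^sup>2)) (at v)" for v
      unfolding has_real_derivative_iff_has_vector_derivative[symmetric]
      by (auto intro!: derivative_eq_intros)
  qed (use d bd in \<open>auto simp: norm_mult\<close>)
  also have "\<dots> = B * (arctan v2 - arctan v1)"
    by (simp add: algebra_simps)
  also have "\<dots> \<le> B * pi"
    using arctan_bounded[of v1] arctan_bounded[of v2] assms by (intro mult_left_mono) auto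
  finally show ?thesis .
qed (use assms in auto)

section \<open>The function \<open>Ai_Gamma_lower\<close>\<close>

lemma linear_minus_square_le:
  fixes k w e :: real
  assumes "e > 0"
  shows "k * w - e * w\<^sup>2 \<le> k\<^sup>2 / (4 * e)"
proof -
  have "0 \<le> (2 * e * w - k)\<^sup>2" by simp
  then show ?thesis using assms by (simp add: field_simps power2_eq_square)
qed

lemma Re_cube: "Re (Complex x v ^ 3) = x ^ 3 - 3 * x * v\<^sup>2"
  by (simp add: power3_eq_cube power2_eq_square algebra_simps)

text \<open>The real part of \<open>z ^ 3 / 3\<close> contains \<open>- x * v\<^sup>2\<close>, and
  this Gaussian decay beats the exponential growth of \<open>rGamma\<close> in \<open>v\<close>. The
  factor \<open>b\<close>, from \<open>rGamma w = w * rGamma (1 + w)\<close>, will cancel the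
  \<open>1 / b\<close> of \<open>Ai_Gamma_upper\<close>.\<close>

lemma lower_integrand_le:
  assumes "e > 0"
  obtains C where "C > 0"
    "\<And>a b x v. 0 < b \<Longrightarrow> b \<le> b0 \<Longrightarrow> e \<le> x \<Longrightarrow>
      cmod (exp (Complex x v ^ 3 / 3 - of_real a * Complex x v) * rGamma (of_real b * Complex x v))
        \<le> b * C * (1 + x) * exp (x ^ 3 / 3 - a * x) * inverse (1 + v\<^sup>2)"
proof -
  obtain G where G: "G > 0" "\<And>x. x \<ge> 0 \<Longrightarrow> rGamma (1 + x) \<le> (G::real)"
    using rGamma_1_plus_bounded by blast
  \<comment> \<open>\<open>k\<close> collects the exponents linear in \<open>\<bar>v\<bar>\<close>:
    \<open>3\<close> dominates the polynomial factors
    \<open>(1 + \<bar>v\<bar>) * (1 + v\<^sup>2)\<close>, and \<open>pi * b0 / 2\<close> comes from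
    \<open>rGamma\<close>.\<close>
  define k where "k = 3 + pi * b0 / 2"
  define C where "C = G * exp (k\<^sup>2 / (4 * e))"
  have "cmod (exp (Complex x v ^ 3 / 3 - of_real a * Complex x v) * rGamma (of_real b * Complex x v))
        \<le> b * C * (1 + x) * exp (x ^ 3 / 3 - a * x) * inverse (1 + v\<^sup>2)"
    if b: "0 < b" "b \<le> b0" and x: "e \<le> x" for a b x v
  proof -
    define z where "z = Complex x v"
    have x0: "x > 0" using assms x by simp
    have bz: "of_real b * z = Complex (b * x) (b * v)" "1 + of_real b * z = Complex (1 + b * x) (b * v)"
      by (auto simp: z_def complex_eq_iff)
    have "rGamma (of_real b * z) = of_real b * z * rGamma (1 + of_real b * z)"
      using rGamma_plus1[of "of_real b * z"] by (simp add: add.commute)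
    then have "cmod (rGamma (of_real b * z)) = b * cmod z * cmod (rGamma (Complex (1 + b * x) (b * v)))"
      using b by (simp add: norm_mult bz(2))
    also have "\<dots> \<le> b * ((1 + x) * (1 + \<bar>v\<bar>)) * (G * exp (pi * b0 / 2 * \<bar>v\<bar>))"
    proof (intro mult_mono)
      have "cmod z \<le> \<bar>x\<bar> + \<bar>v\<bar>" using cmod_le[of z] by (simp add: z_def)
      also have "\<dots> \<le> (1 + x) * (1 + \<bar>v\<bar>)" using x0 by (simp add: algebra_simps)
      finally show "cmod z \<le> (1 + x) * (1 + \<bar>v\<bar>)" .
      have "cmod (rGamma (Complex (1 + b * x) (b * v))) \<le> rGamma (1 + b * x) * cmod (rGamma (Complex 1 (b * v)))"
        using b x0 by (intro cmod_rGamma_le) auto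
      also have "\<dots> \<le> G * exp (pi * b0 / 2 * \<bar>v\<bar>)"
      proof (rule mult_mono)
        have "cmod (rGamma (Complex 1 (b * v))) \<le> exp (pi * \<bar>b * v\<bar> / 2)"
          by (rule cmod_rGamma_Complex_1_le)
        also have "\<dots> \<le> exp (pi * b0 / 2 * \<bar>v\<bar>)"
          using b by (auto simp: abs_mult intro!: mult_left_mono mult_right_mono)
        finally show "cmod (rGamma (Complex 1 (b * v))) \<le> exp (pi * b0 / 2 * \<bar>v\<bar>)" .
      qed (use G b x0 in auto)
      finally show "cmod (rGamma (Complex (1 + b * x) (b * v))) \<le> G * exp (pi * b0 / 2 * \<bar>v\<bar>)" .
    qed (use b x0 in auto)
    finally have rG: "cmod (rGamma (of_real b * z)) \<le> b * ((1 + x) * (1 + \<bar>v\<bar>)) * (G * exp (pi * b0 / 2 * \<bar>v\<bar>))" .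
    have E: "cmod (exp (z ^ 3 / 3 - of_real a * z)) = exp (x ^ 3 / 3 - a * x) * exp (- (x * v\<^sup>2))"
    proof -
      have "Re (z ^ 3 / 3 - of_real a * z) = x ^ 3 / 3 - a * x + - (x * v\<^sup>2)"
        using Re_cube[of x v] by (simp add: z_def Re_divide_numeral)
      then show ?thesis unfolding norm_exp_eq_Re by (simp only: exp_add)
    qed
    have "cmod (exp (z ^ 3 / 3 - of_real a * z) * rGamma (of_real b * z))
      \<le> (exp (x ^ 3 / 3 - a * x) * exp (- (x * v\<^sup>2))) * (b * ((1 + x) * (1 + \<bar>v\<bar>)) * (G * exp (pi * b0 / 2 * \<bar>v\<bar>)))"
      unfolding norm_mult E by (intro mult_left_mono rG) auto
    also have "\<dots> = b * G * (1 + x) * exp (x ^ 3 / 3 - a * x)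
        * ((1 + \<bar>v\<bar>) * (exp (pi * b0 / 2 * \<bar>v\<bar>) * exp (- (x * v\<^sup>2))))"
      by (simp only: mult_ac)
    also have "(1 + \<bar>v\<bar>) * (exp (pi * b0 / 2 * \<bar>v\<bar>) * exp (- (x * v\<^sup>2)))
        \<le> exp (k\<^sup>2 / (4 * e)) * inverse (1 + v\<^sup>2)"
    proof -
      have e1: "1 + \<bar>v\<bar> \<le> exp \<bar>v\<bar>" by (rule exp_ge_add_one_self)
      have "1 + v\<^sup>2 \<le> (1 + \<bar>v\<bar>)\<^sup>2" by (simp add: power2_eq_square algebra_simps)
      also have "\<dots> \<le> (exp \<bar>v\<bar>)\<^sup>2" using e1 by (intro power_mono) auto
      finally have "(1 + \<bar>v\<bar>) * (1 + v\<^sup>2) * exp (pi * b0 / 2 * \<bar>v\<bar>) * exp (- (x * v\<^sup>2))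
        \<le> exp \<bar>v\<bar> * (exp \<bar>v\<bar>)\<^sup>2 * exp (pi * b0 / 2 * \<bar>v\<bar>) * exp (- (e * v\<^sup>2))"
        using x e1 by (intro mult_mono) (auto intro: mult_right_mono)
      also have "\<dots> = exp (k * \<bar>v\<bar> - e * \<bar>v\<bar>\<^sup>2)"
        by (simp add: k_def power2_eq_square algebra_simps flip: exp_add)
      also have "\<dots> \<le> exp (k\<^sup>2 / (4 * e))"
        using linear_minus_square_le[OF assms, of k "\<bar>v\<bar>"] by simp
      finally show ?thesis
        by (simp add: field_simps add_pos_nonneg)
    qed
    finally show ?thesis
      using b x0 G by (simp add: C_def z_def mult_left_mono mult_ac)
  qed
  moreover have "C > 0" using G by (simp add: C_def)
  ultimately show ?thesis using that by blast
qed

text \<open>The line of integration is moved from \<open>Re z = 1\<close> to \<open>Re z = d\<close>.\<close>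
lemma cmod_Ai_Gamma_lower_le:
  assumes e: "0 < e" "e \<le> 1"
  obtains C where "C > 0"
    "\<And>a b d. 0 < b \<Longrightarrow> b \<le> b0 \<Longrightarrow> e \<le> d \<Longrightarrow>
      cmod (Ai_Gamma_lower a b 0) \<le> b * C * (1 + d) * exp (d ^ 3 / 3 - a * d)"
proof -
  obtain C where C: "C > 0" "\<And>a b x v. 0 < b \<Longrightarrow> b \<le> b0 \<Longrightarrow> e \<le> x \<Longrightarrow>
      cmod (exp (Complex x v ^ 3 / 3 - of_real a * Complex x v) * rGamma (of_real b * Complex x v))
        \<le> b * C * (1 + x) * exp (x ^ 3 / 3 - a * x) * inverse (1 + v\<^sup>2)"
    using lower_integrand_le[OF e(1), of b0] by blast
  have "cmod (Ai_Gamma_lower a b 0) \<le> b * C * (1 + d) * exp (d ^ 3 / 3 - a * d)"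
    if b: "0 < b" "b \<le> b0" and d: "e \<le> d" for a b d
  proof -
    define f where "f z = exp (z ^ 3 / 3 - of_real a * z) * rGamma (of_real b * z)" for z :: complex
    define h where "h x = b * C * (1 + x) * exp (x ^ 3 / 3 - a * x)" for x
    have fh: "cmod (f (Complex x v)) \<le> h x * inverse (1 + v\<^sup>2)" if "e \<le> x" for x v
      using C(2)[OF b that] by (simp add: f_def h_def)
    have h0: "h x \<ge> 0" if "e \<le> x" for x
      using that b C e by (simp add: h_def)
    have holf: "f holomorphic_on UNIV"
      unfolding f_def by (intro holomorphic_intros) auto
    \<comment> \<open>\<open>rGamma\<close> is entire, so one primitive serves the whole plane and
      moving the line costs only the horizontal connections at its two ends.\<close>
    then obtain F where F: "\<And>z. (F has_field_derivative f z) (at z)"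
      using holomorphic_convex_primitive'[of UNIV f] by auto
    have ray: "((\<lambda>r. F (1 + of_real r * w) - F 1) \<longlongrightarrow> ray_integral 1 w f) at_top"
      if w: "w = Complex 0 s" "\<bar>s\<bar> = 1" for w s
    proof (rule ray_integral_tendsto_primitive[where S = UNIV])
      show "\<forall>\<^sub>F r in at_top. cmod (f (1 + of_real r * w)) \<le> h 1 * inverse (1 + r\<^sup>2)"
      proof (rule always_eventually, rule allI)
        fix r
        have "1 + of_real r * w = Complex 1 (r * s)" using w by (simp add: complex_eq_iff)
        moreover have "(r * s)\<^sup>2 = r\<^sup>2"
          using w(2) by (simp add: power_mult_distrib flip: power2_abs[of s])
        ultimately show "cmod (f (1 + of_real r * w)) \<le> h 1 * inverse (1 + r\<^sup>2)"
          using fh[of 1 "r * s"] e by simp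
      qed
    qed (use F holf in \<open>auto intro: holomorphic_on_imp_continuous_on\<close>)
    have "((\<lambda>r. (F (1 + of_real r * \<i>) - F 1) - (F (1 + of_real r * (- \<i>)) - F 1))
        \<longlongrightarrow> ray_integral 1 \<i> f - ray_integral 1 (- \<i>) f) at_top"
      by (intro tendsto_diff ray[of _ 1] ray[of _ "- 1"]) (auto simp: complex_eq_iff)
    then have lim: "((\<lambda>r. cmod (F (Complex 1 r) - F (Complex 1 (- r)))) \<longlongrightarrow> cmod (ray_integral 1 \<i> f - ray_integral 1 (- \<i>) f)) at_top"
    proof (rule tendsto_norm[THEN filterlim_cong[THEN iffD1, rotated -1]], goal_cases)
      case 3
      then show ?case
        by (intro always_eventually allI arg_cong[where f = cmod])
          (simp add: complex_eq_iff Complex_eq mult.commute)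
    qed auto
    define I where "I = {min 1 d..max 1 d}"
    have "compact I" "continuous_on I h"
      unfolding I_def h_def by (auto intro!: continuous_intros)
    then obtain K where K: "K > 0" "\<And>x. x \<in> I \<Longrightarrow> norm (h x) \<le> K"
      by (rule continuous_on_compact_bounded) blast
    \<comment> \<open>The connections at height \<open>v\<close> have fixed length
      \<open>\<bar>1 - d\<bar>\<close> and a decaying integrand, so they vanish in the
      limit.\<close>
    have hor: "cmod (F (Complex 1 v) - F (Complex d v)) \<le> K * inverse (1 + v\<^sup>2) * \<bar>1 - d\<bar>" for v
    proof -
      have "cmod (F (Complex 1 v) - F (Complex d v)) \<le> (K * inverse (1 + v\<^sup>2)) * cmod (Complex 1 v - Complex d v)"
      proof (rule field_differentiable_bound)
        fix z assume z: "z \<in> closed_segment (Complex 1 v) (Complex d v)"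
        then have z': "z = Complex (Re z) v" "Re z \<in> I"
          by (auto simp: closed_segment_same_Im closed_segment_eq_real_ivl complex_eq_iff I_def split: if_splits)
        then have "cmod (f z) \<le> h (Re z) * inverse (1 + v\<^sup>2)"
          using fh[of "Re z" v] e d by (auto simp: I_def)
        also have "\<dots> \<le> K * inverse (1 + v\<^sup>2)"
          using K(2)[OF z'(2)] by (intro mult_right_mono) (auto simp: add_nonneg_nonneg)
        finally show "cmod (f z) \<le> K * inverse (1 + v\<^sup>2)" .
        show "(F has_field_derivative f z) (at z within closed_segment (Complex 1 v) (Complex d v))"
          by (rule has_field_derivative_at_within[OF F])
      qed auto
      also have "Complex 1 v - Complex d v = of_real (1 - d)" by (simp add: complex_eq_iff)
      finally show ?thesis by (simp only: norm_of_real)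
    qed
    have vert: "cmod (F (Complex d r) - F (Complex d (- r))) \<le> h d * pi" if "r \<ge> 0" for r
      using that fh[OF d] h0[OF d] F by (intro vertical_increment_le[where f = f]) auto
    have "cmod (ray_integral 1 \<i> f - ray_integral 1 (- \<i>) f) \<le> h d * pi + 2 * (K * 0 * \<bar>1 - d\<bar>)"
    proof (rule tendsto_le[OF _ _ lim])
      show "((\<lambda>r. h d * pi + 2 * (K * inverse (1 + r\<^sup>2) * \<bar>1 - d\<bar>)) \<longlongrightarrow> h d * pi + 2 * (K * 0 * \<bar>1 - d\<bar>)) at_top"
      proof (intro tendsto_intros)
        show "((\<lambda>r::real. inverse (1 + r\<^sup>2)) \<longlongrightarrow> 0) at_top"
          by real_asymp
      qed
      show "\<forall>\<^sub>F r in at_top. cmod (F (Complex 1 r) - F (Complex 1 (- r))) \<le> h d * pi + 2 * (K * inverse (1 + r\<^sup>2) * \<bar>1 - d\<bar>)"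
      proof (rule eventually_mono[OF eventually_ge_at_top[of 0]])
        fix r :: real assume r: "r \<ge> 0"
        have tri: "cmod (x - y) \<le> cmod (x - x') + cmod (x' - y') + cmod (y - y')" for x y x' y' :: complex
          using norm_triangle_ineq4[of "(x - x') + (x' - y')" "y - y'"] norm_triangle_ineq[of "x - x'" "x' - y'"]
          by simp
        have "cmod (F (Complex 1 r) - F (Complex 1 (- r))) \<le> cmod (F (Complex 1 r) - F (Complex d r))
           + cmod (F (Complex d r) - F (Complex d (- r))) + cmod (F (Complex 1 (- r)) - F (Complex d (- r)))"
          by (rule tri)
        also have "\<dots> \<le> K * inverse (1 + r\<^sup>2) * \<bar>1 - d\<bar> + h d * pi + K * inverse (1 + (- r)\<^sup>2) * \<bar>1 - d\<bar>"
          by (intro add_mono hor vert r)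
        finally show "cmod (F (Complex 1 r) - F (Complex 1 (- r))) \<le> h d * pi + 2 * (K * inverse (1 + r\<^sup>2) * \<bar>1 - d\<bar>)"
          by (simp add: mult_ac)
      qed
    qed simp
    then have le: "cmod (ray_integral 1 \<i> f - ray_integral 1 (- \<i>) f) \<le> h d * pi" by simp
    \<comment> \<open>The two forms of the integrand agree even at the poles of
      \<open>Gamma\<close>, where \<open>rGamma\<close> and \<open>1 / Gamma\<close> are both
      \<open>0\<close>.\<close>
    have f: "f = (\<lambda>z. exp (z ^ 3 / 3 - of_real a * z) * (1 / Gamma (of_real b * z + of_real 0)))"
      by (rule ext) (simp only: f_def rGamma_inverse_Gamma inverse_eq_divide of_real_0 add_0_right)
    have "Ai_Gamma_lower a b 0 = 1 / (2 * of_real pi * \<i>) * (ray_integral 1 \<i> f - ray_integral 1 (- \<i>) f)"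
      unfolding Ai_Gamma_lower_def Let_def f ..
    then have "cmod (Ai_Gamma_lower a b 0) = 1 / (2 * pi) * cmod (ray_integral 1 \<i> f - ray_integral 1 (- \<i>) f)"
      by (simp only: norm_mult norm_divide) simp
    also have "\<dots> \<le> 1 / (2 * pi) * (h d * pi)"
      by (intro mult_left_mono le) auto
    also have "\<dots> \<le> h d" using h0[OF d] by simp
    finally show ?thesis by (simp add: h_def)
  qed
  then show ?thesis using that C(1) by blast
qed

section \<open>The function \<open>Ai_Gamma_upper\<close>\<close>

text \<open>Serves both the oblique rays and the horizontal segments joining them to the line
  \<open>Re z = - e\<close>. For \<open>u \<le> V\<close> the cubic contributes at most
  \<open>- 2/3 * u * V\<^sup>2\<close>, while Gamma stays bounded once \<open>b * V \<ge> 1\<close>.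
  The threshold may depend on \<open>a\<close> and \<open>b\<close>, since only a limit is
  taken.\<close>

lemma upper_integrand_tail:
  fixes a b e :: real
  assumes "0 < b" "0 < e"
  shows "\<forall>\<^sub>F V in at_top. \<forall>s u. \<bar>s\<bar> = 1 \<longrightarrow> e \<le> u \<longrightarrow> u \<le> V \<longrightarrow>
    cmod (exp (- (Complex (- u) (s * V) ^ 3 / 3) + of_real a * Complex (- u) (s * V))
      * Gamma (of_real b * Complex (- u) (s * V))) \<le> exp (- V)"
proof -
  obtain C where C: "C > 0" "\<And>z. \<bar>Im z\<bar> \<ge> 1 \<Longrightarrow> Re z \<le> 2 \<Longrightarrow> cmod (Gamma z) \<le> C"
    using cmod_Gamma_bounded_strip by blast
  \<comment> \<open>The last bound makes the quadratic exponent \<open>2/3 * e * V\<^sup>2\<close>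
    exceed \<open>\<bar>a\<bar> * V\<close>, \<open>ln C\<close> and the claimed \<open>V\<close>
    together.\<close>
  define V0 where "V0 = max (max 1 (1 / b)) ((\<bar>ln C\<bar> + \<bar>a\<bar> + 1) / (2 / 3 * e))"
  show ?thesis
  proof (intro eventually_mono[OF eventually_ge_at_top[of V0]] allI impI)
    fix V s u :: real
    assume V: "V0 \<le> V" and s: "\<bar>s\<bar> = 1" and u: "e \<le> u" "u \<le> V"
    define z where "z = Complex (- u) (s * V)"
    have V1: "V \<ge> 1" and Vb: "1 / b \<le> V" and VC: "(\<bar>ln C\<bar> + \<bar>a\<bar> + 1) / (2 / 3 * e) \<le> V"
      using V by (simp_all add: V0_def)
    have bV: "b * V \<ge> 1"
      using Vb assms by (simp add: field_simps)
    have "\<bar>Im (of_real b * z)\<bar> = b * V"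
      using s V1 assms by (simp add: z_def abs_mult)
    moreover have "Re (of_real b * z) \<le> 0"
      using u assms by (simp add: z_def)
    ultimately have G: "cmod (Gamma (of_real b * z)) \<le> C"
      using bV by (intro C) auto
    have s2: "s\<^sup>2 = 1" using s by (simp flip: power2_abs[of s])
    have "Re (- (z ^ 3 / 3) + of_real a * z) = u ^ 3 / 3 - u * V\<^sup>2 - a * u"
      using Re_cube[of "- u" "s * V"] s2 by (simp add: z_def power_mult_distrib Re_divide_numeral field_simps)
    also have "\<dots> \<le> u * V\<^sup>2 / 3 - u * V\<^sup>2 + \<bar>a\<bar> * V"
    proof -
      have "u\<^sup>2 \<le> V\<^sup>2" using u assms by (intro power_mono) auto
      then have "u * u\<^sup>2 \<le> u * V\<^sup>2" using u assms by (intro mult_left_mono) auto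
      then have "u ^ 3 \<le> u * V\<^sup>2" by (simp add: power3_eq_cube power2_eq_square)
      moreover have "- (a * u) \<le> \<bar>a\<bar> * V"
      proof -
        have "- (a * u) \<le> \<bar>a\<bar> * u" using mult_right_mono[of "- a" "\<bar>a\<bar>" u] u assms by simp
        also have "\<dots> \<le> \<bar>a\<bar> * V" using u by (intro mult_left_mono) auto
        finally show ?thesis .
      qed
      ultimately show ?thesis by simp
    qed
    also have "\<dots> = - (2 / 3 * V\<^sup>2) * u + \<bar>a\<bar> * V" by simp
    also have "\<dots> \<le> - (2 / 3 * V\<^sup>2) * e + \<bar>a\<bar> * V"
      using u by (intro add_right_mono mult_left_mono_neg) auto
    finally have E: "cmod (exp (- (z ^ 3 / 3) + of_real a * z)) \<le> exp (- (2 / 3 * V\<^sup>2) * e + \<bar>a\<bar> * V)"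
      unfolding norm_exp_eq_Re by simp
    have "cmod (exp (- (z ^ 3 / 3) + of_real a * z) * Gamma (of_real b * z))
      \<le> exp (- (2 / 3 * V\<^sup>2) * e + \<bar>a\<bar> * V) * C"
      unfolding norm_mult by (intro mult_mono E G) auto
    also have "\<dots> = exp (- (2 / 3 * V\<^sup>2) * e + \<bar>a\<bar> * V + ln C)"
      using C by (simp add: exp_add)
    also have "\<dots> \<le> exp (- V)"
    proof -
      have "\<bar>ln C\<bar> + \<bar>a\<bar> + 1 \<le> V * (2 / 3 * e)"
        using VC assms by (simp add: pos_divide_le_eq)
      then have "(\<bar>ln C\<bar> + \<bar>a\<bar> + 1) * V \<le> V * (2 / 3 * e) * V"
        using V1 by (intro mult_right_mono) auto
      moreover have "\<bar>ln C\<bar> * 1 \<le> \<bar>ln C\<bar> * V"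
        using V1 by (intro mult_left_mono) auto
      ultimately have "- (2 / 3 * V\<^sup>2) * e + \<bar>a\<bar> * V + ln C \<le> - V"
        by (simp add: power2_eq_square algebra_simps)
      then show ?thesis by simp
    qed
    finally show "cmod (exp (- (Complex (- u) (s * V) ^ 3 / 3) + of_real a * Complex (- u) (s * V))
      * Gamma (of_real b * Complex (- u) (s * V))) \<le> exp (- V)"
      by (simp add: z_def)
  qed
qed

text \<open>With \<open>b * e \<le> 1/2\<close> the argument \<open>b * z\<close> runs between the
  poles \<open>0\<close> and \<open>-1\<close>. One use of the functional equation moves its real
  part into \<open>[1/2, 1]\<close>, at the price of the factor \<open>1 / (b * z)\<close>, of
  modulus at most \<open>1 / (b * e)\<close>.\<close>

lemma upper_integrand_le:
  assumes "0 < e" "e \<le> 1" "e * b0 \<le> 1 / 2"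
  obtains C where "C > 0"
    "\<And>a b v. 0 < b \<Longrightarrow> b \<le> b0 \<Longrightarrow>
      cmod (exp (- (Complex (- e) v ^ 3 / 3) + of_real a * Complex (- e) v) * Gamma (of_real b * Complex (- e) v))
        \<le> C / b * exp (- e * a) * inverse (1 + v\<^sup>2)"
proof -
  obtain G where G: "G > 0" "\<And>x. x \<in> {1/2..1} \<Longrightarrow> Gamma x \<le> (G::real)"
    using Gamma_bounded_Icc[of "1/2" 1] by auto
  define C where "C = G / e * exp (e ^ 3 / 3) / e"
  have "cmod (exp (- (Complex (- e) v ^ 3 / 3) + of_real a * Complex (- e) v) * Gamma (of_real b * Complex (- e) v))
        \<le> C / b * exp (- e * a) * inverse (1 + v\<^sup>2)"
    if b: "0 < b" "b \<le> b0" for a b v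
  proof -
    define z where "z = Complex (- e) v"
    have "b * e \<le> e * b0" using mult_left_mono[of b b0 e] b assms by (simp add: mult.commute)
    then have be: "0 < b * e" "b * e \<le> 1 / 2"
      using b assms by (simp, linarith)
    have Rz: "Re (of_real b * z) = - (b * e)" by (simp add: z_def)
    have nz: "of_real b * z \<notin> \<int>\<^sub>\<le>\<^sub>0"
    proof
      assume "of_real b * z \<in> \<int>\<^sub>\<le>\<^sub>0"
      then obtain n :: nat where "of_real b * z = - of_nat n" by (elim nonpos_Ints_cases')
      with Rz have "real n = b * e" by simp
      then show False using be by (cases n) auto
    qed
    have "Gamma (of_real b * z + 1) = of_real b * z * Gamma (of_real b * z)"
      by (rule Gamma_plus1[OF nz])
    then have "b * cmod z * cmod (Gamma (of_real b * z)) = cmod (Gamma (of_real b * z + 1))"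
      using b by (simp add: norm_mult)
    also have "\<dots> \<le> Gamma (Re (of_real b * z + 1))"
      using be Rz by (intro cmod_Gamma_le_Gamma_Re) auto
    also have "\<dots> \<le> G"
      using be Rz by (intro G) auto
    finally have 1: "b * cmod z * cmod (Gamma (of_real b * z)) \<le> G" .
    have "e \<le> cmod z"
      using abs_Re_le_cmod[of z] assms by (simp add: z_def)
    then have "b * e * cmod (Gamma (of_real b * z)) \<le> b * cmod z * cmod (Gamma (of_real b * z))"
      using b by (intro mult_right_mono mult_left_mono) auto
    with 1 have "b * e * cmod (Gamma (of_real b * z)) \<le> G" by simp
    then have Gz: "cmod (Gamma (of_real b * z)) \<le> G / e / b"
      using b assms by (simp add: field_simps)
    have "Re (- (z ^ 3 / 3) + of_real a * z) = e ^ 3 / 3 + (- e * a) + (- (e * v\<^sup>2))"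
      using Re_cube[of "- e" v] by (simp add: z_def Re_divide_numeral field_simps)
    then have E: "cmod (exp (- (z ^ 3 / 3) + of_real a * z)) = exp (e ^ 3 / 3) * exp (- e * a) * exp (- (e * v\<^sup>2))"
      unfolding norm_exp_eq_Re by (simp only: exp_add)
    have gauss: "exp (- (e * v\<^sup>2)) \<le> inverse (1 + v\<^sup>2) / e"
    proof -
      have "e * (1 + v\<^sup>2) \<le> 1 + e * v\<^sup>2" using assms by (simp add: algebra_simps)
      also have "\<dots> \<le> exp (e * v\<^sup>2)" by (rule exp_ge_add_one_self)
      finally have "e * (1 + v\<^sup>2) * exp (- (e * v\<^sup>2)) \<le> exp (e * v\<^sup>2) * exp (- (e * v\<^sup>2))"
        by (intro mult_right_mono) auto
      then have "e * (1 + v\<^sup>2) * exp (- (e * v\<^sup>2)) \<le> 1" by (simp flip: exp_add)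
      moreover have "e * (1 + v\<^sup>2) > 0" using assms by (simp add: add_pos_nonneg)
      ultimately have "exp (- (e * v\<^sup>2)) \<le> 1 / (e * (1 + v\<^sup>2))"
        by (simp only: pos_le_divide_eq mult.commute)
      then show ?thesis by (simp only: divide_inverse inverse_mult_distrib mult_1_left mult.commute)
    qed
    have "cmod (exp (- (z ^ 3 / 3) + of_real a * z) * Gamma (of_real b * z))
      \<le> exp (e ^ 3 / 3) * exp (- e * a) * (inverse (1 + v\<^sup>2) / e) * (G / e / b)"
      unfolding norm_mult E by (intro mult_mono mult_left_mono gauss Gz) (use assms in auto)
    also have "\<dots> = C / b * exp (- e * a) * inverse (1 + v\<^sup>2)"
      by (simp add: C_def mult_ac)
    finally show ?thesis by (simp add: z_def)
  qed
  moreover have "C > 0" using G assms by (simp add: C_def)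
  ultimately show ?thesis using that by blast
qed

text \<open>The contour is moved to the line \<open>Re z = - e\<close>, past the pole at \<open>0\<close> only; its residue
  \<open>1 / b\<close> accounts for the summand \<open>1\<close>.\<close>
lemma cmod_Ai_Gamma_upper_le:
  assumes e: "0 < e" "e \<le> 1" "e * b0 \<le> 1 / 2"
  obtains C where "C > 0"
    "\<And>a b. 0 < b \<Longrightarrow> b \<le> b0 \<Longrightarrow> cmod (Ai_Gamma_upper a b 0) \<le> C / b * (1 + exp (- e * a))"
proof -
  obtain C where C: "C > 0" "\<And>a b v. 0 < b \<Longrightarrow> b \<le> b0 \<Longrightarrow>
      cmod (exp (- (Complex (- e) v ^ 3 / 3) + of_real a * Complex (- e) v) * Gamma (of_real b * Complex (- e) v))
        \<le> C / b * exp (- e * a) * inverse (1 + v\<^sup>2)"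
    using upper_integrand_le[OF e] by blast
  define c where "c s = Complex (- e) s" for s
  \<comment> \<open>A triangle around the pole at \<open>0\<close>, with one side on the new line.
    It depends on \<open>e\<close> alone, so the modulus \<open>W\<close> of its winding number can
    enter the constant without being computed.\<close>
  define \<gamma> where "\<gamma> = linepath (c (- 1)) 1 +++ linepath 1 (c 1) +++ linepath (c 1) (c (- 1))"
  define W where "W = cmod (winding_number \<gamma> 0)"
  \<comment> \<open>\<open>W\<close> accounts for the residue; \<open>2 * C\<close> covers the
    factor \<open>1 + 1 / pi\<close> left by the two half-lines and the short segment after division
    by \<open>2 * pi\<close>.\<close>
  define C' where "C' = W + 2 * C"
  have "cmod (Ai_Gamma_upper a b 0) \<le> C' / b * (1 + exp (- e * a))"
    if b: "0 < b" "b \<le> b0" for a b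
  proof -
    define f where "f z = exp (- (z ^ 3 / 3) + of_real a * z) * Gamma (of_real b * z)" for z :: complex
    define H where "H = C / b * exp (- e * a)"
    have H0: "H \<ge> 0" using C b by (simp add: H_def)
    have fH: "cmod (f (c v)) \<le> H * inverse (1 + v\<^sup>2)" for v
      using C(2)[OF b, of v a] by (simp add: f_def H_def c_def)
    have "b * e \<le> e * b0" using mult_left_mono[of b b0 e] b e by (simp add: mult.commute)
    then have be: "b * e \<le> 1 / 2" using e(3) by linarith
    \<comment> \<open>The plane slit along the nonpositive reals, where all the poles lie, is
      starlike, so the integrand has a primitive on it.\<close>
    define S where "S = - complex_of_real ` {..0}"
    have S_iff: "z \<in> S \<longleftrightarrow> Im z \<noteq> 0 \<or> Re z > 0" for z
      by (auto simp: S_def complex_eq_iff image_iff not_le intro!: bexI[of _ "Re z"])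
    have "S = {z. Im z \<noteq> 0} \<union> {z. Re z > 0}" using S_iff by auto
    moreover have "open {z. Im z \<noteq> 0}"
      by (intro open_Collect_neq continuous_intros)
    ultimately have openS: "open S"
      by (simp add: open_Un open_halfspace_Re_gt)
    have Gamma_nz: "of_real b * z \<notin> \<int>\<^sub>\<le>\<^sub>0" if "z \<in> S" for z
    proof
      assume "of_real b * z \<in> \<int>\<^sub>\<le>\<^sub>0"
      then obtain n :: nat where n: "of_real b * z = - of_nat n" by (elim nonpos_Ints_cases')
      then have "b * Re z = - real n" "b * Im z = 0"
        by (auto simp: complex_eq_iff)
      moreover from this(2) have "Im z = 0" using b by simp
      then have "Re z > 0" using that by (simp add: S_iff)
      then have "b * Re z > 0" using b by simp
      ultimately show False by simp
    qed
    have holf: "f holomorphic_on S"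
      unfolding f_def using Gamma_nz by (intro holomorphic_intros) auto
    have contf: "continuous_on S f"
      using holf by (rule holomorphic_on_imp_continuous_on)
    have "starlike S"
      using starlike_slotted_complex_plane_left[of 0] by (simp add: S_def)
    then have "\<exists>F. \<forall>z\<in>S. (F has_field_derivative f z) (at z)"
      by (rule holomorphic_starlike_primitive[OF contf _ openS, of "{}"])
        (use holf openS in \<open>auto intro: holomorphic_on_imp_differentiable_at\<close>)
    then obtain F where F: "\<And>z. z \<in> S \<Longrightarrow> (F has_field_derivative f z) (at z)"
      by blast
    \<comment> \<open>At distance \<open>r\<close> along a ray from \<open>1\<close>,
      \<open>x r\<close> is both the displacement to the left and the absolute height.\<close>
    define x where "x r = r / sqrt 2" for r :: real
    have xtop: "filterlim x at_top at_top"
      unfolding x_def by real_asymp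
    have tail: "\<forall>\<^sub>F r in at_top. \<forall>s u. \<bar>s\<bar> = 1 \<longrightarrow> e \<le> u \<longrightarrow> u \<le> x r \<longrightarrow>
        cmod (f (Complex (- u) (s * x r))) \<le> exp (- x r)"
      using eventually_compose_filterlim[OF upper_integrand_tail[OF b(1) e(1), of a] xtop]
      by (simp add: f_def)
    have large: "\<forall>\<^sub>F r in at_top. x r \<ge> 2"
      using xtop unfolding filterlim_at_top by blast
    have ray_eq: "1 + of_real r * w = Complex (1 - x r) (s * x r)"
      if "w = Complex (- 1 / sqrt 2) (s / sqrt 2)" for r s w
      using that by (simp add: complex_eq_iff x_def)
    have ray: "((\<lambda>r. F (Complex (1 - x r) (s * x r)) - F 1) \<longlongrightarrow> ray_integral 1 w f) at_top"
      if w: "w = Complex (- 1 / sqrt 2) (s / sqrt 2)" "\<bar>s\<bar> = 1" for w s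
    proof -
      have "((\<lambda>r. F (1 + of_real r * w) - F 1) \<longlongrightarrow> ray_integral 1 w f) at_top"
      proof (rule ray_integral_tendsto_primitive[where S = S and C = 1])
        have "\<forall>\<^sub>F r in at_top. exp (- x r) \<le> 1 * inverse (1 + r\<^sup>2)"
          unfolding x_def by real_asymp
        with tail large show "\<forall>\<^sub>F r in at_top. cmod (f (1 + of_real r * w)) \<le> 1 * inverse (1 + r\<^sup>2)"
        proof eventually_elim
          case (elim r)
          have "cmod (f (Complex (- (x r - 1)) (s * x r))) \<le> exp (- x r)"
            using elim(2) w(2) e by (intro elim(1)[rule_format]) auto
          with elim(3) show ?case by (simp add: ray_eq[OF w(1)])
        qed
        show "1 + of_real r * w \<in> S" if "r \<ge> 0" for r
          using that w(2) unfolding ray_eq[OF w(1)] S_iff by (auto simp: x_def)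
      qed (use F contf openS in auto)
      then show ?thesis by (simp add: ray_eq[OF w(1)])
    qed
    have cis1: "cis (3 * pi / 4) = Complex (- 1 / sqrt 2) (1 / sqrt 2)"
    proof -
      have *: "3 * pi / 4 = pi - pi / 4" by simp
      have **: "sqrt 2 / 2 = 1 / sqrt 2" by (simp add: field_simps)
      have "cos (3 * pi / 4) = - (1 / sqrt 2)" "sin (3 * pi / 4) = 1 / sqrt 2"
        unfolding * cos_pi_minus sin_pi_minus cos_45 sin_45 ** by (rule refl)+
      then show ?thesis by (simp add: complex_eq_iff)
    qed
    have cis2: "cis (- (3 * pi / 4)) = Complex (- 1 / sqrt 2) (- 1 / sqrt 2)"
      using cis_cnj[of "3 * pi / 4"] by (simp add: cis1 complex_eq_iff flip: cis_cnj)
    define I where "I = ray_integral 1 (cis (3 * pi / 4)) f - ray_integral 1 (cis (- (3 * pi / 4))) f"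
    have "((\<lambda>r. (F (Complex (1 - x r) (1 * x r)) - F 1) - (F (Complex (1 - x r) (- 1 * x r)) - F 1)) \<longlongrightarrow> I) at_top"
      unfolding I_def by (intro tendsto_diff ray) (auto simp: cis1 cis2)
    then have lim: "((\<lambda>r. cmod (F (Complex (1 - x r) (x r)) - F (Complex (1 - x r) (- x r)))) \<longlongrightarrow> cmod I) at_top"
      by (intro tendsto_norm) simp
    \<comment> \<open>Horizontal segments at nonzero height avoid the slit. Their length is at most
      \<open>x r\<close>, against an integrand of size \<open>exp (- x r)\<close>.\<close>
    have hor: "\<forall>\<^sub>F r in at_top. cmod (F (Complex (1 - x r) (s * x r)) - F (c (s * x r))) \<le> exp (- x r) * x r"
      if s: "\<bar>s\<bar> = 1" for s
      using tail large
    proof eventually_elim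
      case (elim r)
      have "cmod (F (Complex (1 - x r) (s * x r)) - F (c (s * x r)))
          \<le> exp (- x r) * cmod (Complex (1 - x r) (s * x r) - c (s * x r))"
      proof (rule field_differentiable_bound)
        fix z assume "z \<in> closed_segment (Complex (1 - x r) (s * x r)) (c (s * x r))"
        then have z: "Im z = s * x r" "1 - x r \<le> Re z" "Re z \<le> - e"
          using elim(2) e by (auto simp: c_def closed_segment_same_Im closed_segment_eq_real_ivl split: if_splits)
        have "Complex (- (- Re z)) (s * x r) = z" using z(1) by (simp add: complex_eq_iff)
        moreover have "cmod (f (Complex (- (- Re z)) (s * x r))) \<le> exp (- x r)"
          using s z elim(2) by (intro elim(1)[rule_format]) auto
        ultimately show "cmod (f z) \<le> exp (- x r)" by simp
        have "z \<in> S" using z s elim(2) by (auto simp: S_iff)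
        then show "(F has_field_derivative f z) (at z within closed_segment (Complex (1 - x r) (s * x r)) (c (s * x r)))"
          by (rule has_field_derivative_at_within[OF F])
      qed auto
      also have "Complex (1 - x r) (s * x r) - c (s * x r) = of_real (1 - x r + e)"
        by (simp add: c_def complex_eq_iff)
      also have "exp (- x r) * cmod (of_real (1 - x r + e)) \<le> exp (- x r) * x r"
        using elim(2) e by (intro mult_left_mono) (auto simp: norm_of_real simp del: of_real_diff of_real_add)
      finally show ?case .
    qed
    have seg1: "closed_segment (c s) 1 \<subseteq> S" if "s = 1 \<or> s = - 1" for s
    proof
      fix z assume "z \<in> closed_segment (c s) 1"
      then obtain t where t: "0 \<le> t" "t \<le> 1" "z = (1 - t) *\<^sub>R c s + t *\<^sub>R 1"
        by (auto simp: closed_segment_def)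
      then have "Im z = (1 - t) * s" "t = 1 \<Longrightarrow> Re z = 1" by (auto simp: c_def)
      then show "z \<in> S" using that by (cases "t = 1") (auto simp: S_iff)
    qed
    have cS: "closed_segment (c 1) (c (- 1)) = {z. Re z = - e \<and> \<bar>Im z\<bar> \<le> 1}"
      by (auto simp: c_def closed_segment_same_Re closed_segment_eq_real_ivl abs_le_iff)
    \<comment> \<open>The segment from \<open>c 1\<close> to \<open>c (- 1)\<close> crosses the
      slit, so \<open>F\<close> is not a primitive along it. The increment of \<open>F\<close> is
      instead read off from the triangle, as the residue minus the integral over this
      segment.\<close>
    have core: "cmod (F (c 1) - F (c (- 1))) \<le> 2 * pi * W / b + 2 * H"
    proof -
      \<comment> \<open>The functional equation gives \<open>f z = g z / z\<close> with
        \<open>g\<close> holomorphic to the right of the next pole, the form required by Cauchy's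
        formula.\<close>
      define g where "g z = exp (- (z ^ 3 / 3) + of_real a * z) * Gamma (of_real b * z + 1) / of_real b" for z :: complex
      define T where "T = {z. Re z > - (1 / b)}"
      have T_nz: "of_real b * z + 1 \<notin> \<int>\<^sub>\<le>\<^sub>0" if "z \<in> T" for z
      proof -
        have *: "Re (of_real b * z + 1) > 0" using that b by (simp add: T_def field_simps)
        show ?thesis
        proof
          assume "of_real b * z + 1 \<in> \<int>\<^sub>\<le>\<^sub>0"
          then obtain n :: nat where "of_real b * z + 1 = - of_nat n" by (elim nonpos_Ints_cases')
          then have "Re (of_real b * z + 1) = - real n" by simp
          with * show False by simp
        qed
      qed
      have holg: "g holomorphic_on T"
        unfolding g_def using T_nz b by (intro holomorphic_intros) auto
      have gf: "g z / (z - 0) = f z" if "of_real b * z \<notin> \<int>\<^sub>\<le>\<^sub>0" for z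
      proof -
        have "z \<noteq> 0" using that by auto
        then show ?thesis using Gamma_plus1[OF that] b by (simp add: g_def f_def)
      qed
      have f1: "(f has_contour_integral (F 1 - F (c (- 1)))) (linepath (c (- 1)) 1)"
        using contour_integral_primitive[of S F f "linepath (c (- 1)) 1"] F seg1[of "- 1"]
        by (auto intro: has_field_derivative_at_within)
      have f2: "(f has_contour_integral (F (c 1) - F 1)) (linepath 1 (c 1))"
        using contour_integral_primitive[of S F f "linepath 1 (c 1)"] F seg1[of 1]
        by (auto intro: has_field_derivative_at_within simp: closed_segment_commute)
      have nz3: "of_real b * z \<notin> \<int>\<^sub>\<le>\<^sub>0" if "Re z = - e" for z
      proof
        assume "of_real b * z \<in> \<int>\<^sub>\<le>\<^sub>0"
        then obtain n :: nat where "of_real b * z = - of_nat n" by (elim nonpos_Ints_cases')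
        then have "b * Re z = - real n" by (auto simp: complex_eq_iff)
        then have "real n = b * e" using that by simp
        then show False using be b e by (cases n) auto
      qed
      have "f contour_integrable_on linepath (c 1) (c (- 1))"
      proof (rule contour_integrable_continuous_linepath)
        have "f holomorphic_on closed_segment (c 1) (c (- 1))"
          unfolding f_def using nz3 cS by (intro holomorphic_intros) auto
        then show "continuous_on (closed_segment (c 1) (c (- 1))) f"
          by (rule holomorphic_on_imp_continuous_on)
      qed
      then obtain X where f3: "(f has_contour_integral X) (linepath (c 1) (c (- 1)))"
        by (auto simp: contour_integrable_on_def)
      have "cmod X \<le> H * cmod (c (- 1) - c 1)"
      proof (rule has_contour_integral_bound_linepath[OF f3 H0])
        fix z assume "z \<in> closed_segment (c 1) (c (- 1))"
        then have "z = c (Im z)" by (simp add: cS) (simp add: c_def complex_eq_iff)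
        then have "cmod (f z) \<le> H * inverse (1 + (Im z)\<^sup>2)" using fH by metis
        also have "\<dots> \<le> H * 1"
          using H0 by (intro mult_left_mono) (auto simp: inverse_le_1_iff)
        finally show "cmod (f z) \<le> H" by simp
      qed
      also have "c (- 1) - c 1 = Complex 0 (- 2)" by (simp add: c_def complex_eq_iff)
      also have "cmod (Complex 0 (- 2)) = 2" by (simp add: cmod_def)
      finally have X: "cmod X \<le> 2 * H" by simp
      have pim: "path_image \<gamma> = closed_segment (c (- 1)) 1 \<union> (closed_segment 1 (c 1) \<union> closed_segment (c 1) (c (- 1)))"
        unfolding \<gamma>_def by (subst path_image_join | simp)+
      have nzg: "of_real b * z \<notin> \<int>\<^sub>\<le>\<^sub>0" if "z \<in> path_image \<gamma>" for z
        using that seg1[of 1] seg1[of "- 1"] Gamma_nz[of z] nz3[of z]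
        unfolding pim cS by (auto simp: closed_segment_commute)
      have convT: "convex T" unfolding T_def by (rule convex_halfspace_Re_gt)
      have openT: "open T" unfolding T_def by (rule open_halfspace_Re_gt)
      have ends: "c 1 \<in> T" "c (- 1) \<in> T" "1 \<in> T" "0 \<in> T"
        using b be by (auto simp: T_def c_def field_simps)
      have "path_image \<gamma> \<subseteq> T"
        unfolding pim using ends convT by (simp add: closed_segment_subset)
      moreover have "0 \<notin> path_image \<gamma>" using nzg[of 0] by auto
      ultimately have pT: "path_image \<gamma> \<subseteq> T - {0}" by auto
      have "((\<lambda>w. g w / (w - 0)) has_contour_integral (2 * pi * \<i> * winding_number \<gamma> 0 * g 0)) \<gamma>"
        using pT convT openT ends holg
        by (intro Cauchy_integral_formula_convex_simple[of T])
           (auto simp: interior_open \<gamma>_def)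
      then have 1: "(f has_contour_integral (2 * pi * \<i> * winding_number \<gamma> 0 * g 0)) \<gamma>"
        by (rule has_contour_integral_eq) (use gf nzg in auto)
      have 2: "(f has_contour_integral ((F 1 - F (c (- 1))) + ((F (c 1) - F 1) + X))) \<gamma>"
        unfolding \<gamma>_def by (intro has_contour_integral_join f1 f2 f3) auto
      have "g 0 = 1 / of_real b" by (simp add: g_def)
      with has_contour_integral_unique[OF 1 2]
      have "F (c 1) - F (c (- 1)) = 2 * pi * \<i> * winding_number \<gamma> 0 / of_real b - X"
        by (simp add: algebra_simps)
      then have "cmod (F (c 1) - F (c (- 1))) \<le> cmod (2 * pi * \<i> * winding_number \<gamma> 0 / of_real b) + cmod X"
        by (simp only: norm_triangle_ineq4)
      also have "cmod (2 * pi * \<i> * winding_number \<gamma> 0 / of_real b) = 2 * pi * W / b"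
        using b by (simp add: W_def norm_mult norm_divide)
      finally show ?thesis using X by simp
    qed
    have vert: "cmod (F (c (x r)) - F (c 1)) \<le> H * pi" "cmod (F (c (- 1)) - F (c (- x r))) \<le> H * pi"
      if "x r \<ge> 2" for r
      using that H0 fH F S_iff unfolding c_def
      by (intro vertical_increment_le[where f = f]; auto simp: c_def)+
    \<comment> \<open>The three summands come from the two horizontal segments, the two vertical
      half-lines outside height \<open>1\<close>, and the crossing of the slit.\<close>
    have "cmod I \<le> 2 * 0 + 2 * (H * pi) + (2 * pi * W / b + 2 * H)"
    proof (rule tendsto_le[OF _ _ lim])
      show "((\<lambda>r. 2 * (exp (- x r) * x r) + 2 * (H * pi) + (2 * pi * W / b + 2 * H))
          \<longlongrightarrow> 2 * 0 + 2 * (H * pi) + (2 * pi * W / b + 2 * H)) at_top"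
      proof (intro tendsto_intros)
        show "((\<lambda>r. exp (- x r) * x r) \<longlongrightarrow> 0) at_top"
          unfolding x_def by real_asymp
      qed
      have "\<forall>\<^sub>F r in at_top. cmod (F (Complex (1 - x r) (1 * x r)) - F (c (1 * x r))) \<le> exp (- x r) * x r"
        "\<forall>\<^sub>F r in at_top. cmod (F (Complex (1 - x r) (- 1 * x r)) - F (c (- 1 * x r))) \<le> exp (- x r) * x r"
        by (intro hor; simp)+
      then show "\<forall>\<^sub>F r in at_top. cmod (F (Complex (1 - x r) (x r)) - F (Complex (1 - x r) (- x r)))
          \<le> 2 * (exp (- x r) * x r) + 2 * (H * pi) + (2 * pi * W / b + 2 * H)"
        using large
      proof eventually_elim
        case (elim r)
        have tri: "cmod (p - q) \<le> cmod (p - p1) + cmod (q - q1) + cmod (p1 - p2) + cmod (q2 - q1) + cmod (p2 - q2)"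
          for p p1 p2 q q1 q2 :: complex
          using norm_triangle_ineq4[of "(p - p1) + (p1 - p2) + (p2 - q2) + (q2 - q1)" "q - q1"]
            norm_triangle_ineq[of "(p - p1) + (p1 - p2) + (p2 - q2)" "q2 - q1"]
            norm_triangle_ineq[of "(p - p1) + (p1 - p2)" "p2 - q2"]
            norm_triangle_ineq[of "p - p1" "p1 - p2"] by simp
        show ?case
          using tri[of "F (Complex (1 - x r) (x r))" "F (Complex (1 - x r) (- x r))" "F (c (x r))"
              "F (c (- x r))" "F (c 1)" "F (c (- 1))"] elim vert[OF elim(3)] core
          by simp
      qed
    qed simp
    then have le: "cmod I \<le> 2 * pi * W / b + (2 * pi + 2) * H"
      by (simp add: algebra_simps)
    have f: "f = (\<lambda>z. exp (- (z ^ 3 / 3) + of_real a * z) * Gamma (of_real b * z + of_real 0))"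
      by (rule ext) (simp only: f_def of_real_0 add_0_right)
    have "Ai_Gamma_upper a b 0 = 1 / (2 * of_real pi * \<i>) * I"
      unfolding Ai_Gamma_upper_def Let_def I_def f ..
    then have "cmod (Ai_Gamma_upper a b 0) = 1 / (2 * pi) * cmod I"
      by (simp only: norm_mult norm_divide) simp
    also have "\<dots> \<le> 1 / (2 * pi) * (2 * pi * W / b + (2 * pi + 2) * H)"
      by (intro mult_left_mono le) auto
    also have "\<dots> = W / b + (1 + 1 / pi) * H"
      by (simp add: field_simps)
    also have "\<dots> \<le> C' / b * 1 + 2 * H"
    proof (intro add_mono mult_right_mono)
      show "W / b \<le> C' / b * 1"
        using b C by (simp add: C'_def divide_right_mono)
      show "1 + 1 / pi \<le> 2" using pi_ge_two by (simp add: field_simps)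
    qed (rule H0)
    also have "2 * H \<le> C' / b * exp (- e * a)"
    proof -
      have "2 * C / b \<le> C' / b"
        using b by (intro divide_right_mono) (auto simp: C'_def W_def)
      then have "2 * C / b * exp (- e * a) \<le> C' / b * exp (- e * a)"
        by (rule mult_right_mono) simp
      then show ?thesis by (simp add: H_def)
    qed
    finally show ?thesis by (simp add: distrib_left)
  qed
  moreover have "C' > 0" using C by (simp add: C'_def W_def add_nonneg_pos)
  ultimately show ?thesis using that by blast
qed

subsection \<open>The kernel\<close>

text \<open>Triangle inequality for \<open>x + \<i>\<close>: the roots are its distances to
  \<open>0\<close> and to \<open>r\<close>.\<close>

lemma weight_le_1_plus:
  fixes x r :: real
  assumes "x \<ge> 0" "r \<ge> 0"
  shows "sqrt (1 + x\<^sup>2) \<le> sqrt (1 + (x - r)\<^sup>2) + r"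
proof -
  have "cmod (Complex x 1) \<le> cmod (Complex (x - r) 1) + cmod (of_real r)"
    by (rule order_trans[OF _ norm_triangle_ineq]) (simp add: complex_eq_iff Complex_eq)
  then show ?thesis using assms by (simp add: cmod_def add.commute)
qed

lemma arsinh_le_ln:
  assumes "\<bar>z\<bar> \<le> 2 * m" "m \<ge> 1"
  shows "arsinh (z::real) \<le> ln (5 * m)"
proof -
  have "z\<^sup>2 \<le> (2 * m)\<^sup>2" using assms by (metis abs_le_square_iff abs_of_nonneg order_trans abs_ge_zero)
  moreover have "1 * 1 \<le> m * m" using assms by (intro mult_mono) auto
  ultimately have "z\<^sup>2 + 1 \<le> (3 * m)\<^sup>2" by (simp add: power2_eq_square)
  then have "sqrt (z\<^sup>2 + 1) \<le> 3 * m" using assms by (intro real_le_lsqrt) auto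
  then have "z + sqrt (z\<^sup>2 + 1) \<le> 5 * m" using assms by simp
  then show ?thesis
    using arsinh_real_aux[of z] assms unfolding arsinh_real_def by (intro ln_mono) auto
qed

text \<open>With \<open>u = - t\<close>, the quotient is the weight of the kernel on a ray of the
  contour and \<open>exp (\<kappa> * u / 8)\<close> the growth allowed for the Airy product. Up to
  \<open>exp (\<kappa> * u) = 2 * m\<close> the weight is at most \<open>1\<close> plus the
  derivative of an \<open>arsinh\<close>, so the peak costs only a logarithm; beyond, it decays
  exponentially.\<close>

lemma nn_integral_weight_le:
  fixes x \<kappa> :: real
  assumes x: "x \<ge> 0" and k: "\<kappa> > 0"
  defines "m \<equiv> sqrt (1 + x\<^sup>2)"
  shows "(\<integral>\<^sup>+u. ennreal (m / sqrt (1 + (x - exp (\<kappa> * u))\<^sup>2) * exp (\<kappa> * u / 8)) * indicator {0..} u \<partial>lborel)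
    \<le> ennreal (51 / \<kappa> * m powr (1 / 4))"
proof -
  have m1: "m \<ge> 1" by (simp add: m_def)
  have mx: "x \<le> m" unfolding m_def by (rule real_le_rsqrt) simp
  define q where "q r = sqrt (1 + (x - r)\<^sup>2)" for r
  have q0: "q r \<ge> 1" for r by (simp add: q_def)
  have mq: "m \<le> q r + r" if "r \<ge> 0" for r
    using weight_le_1_plus[OF x that] by (simp add: q_def m_def)
  define U where "U = ln (2 * m) / \<kappa>"
  have U: "U \<ge> 0" "exp (\<kappa> * U) = 2 * m" using m1 k by (simp_all add: U_def)
  define P where "P = (2 * m) powr (1 / 8)"
  have P: "exp (\<kappa> * U / 8) = P" using m1 k by (simp add: P_def U_def powr_def)
  define f1 where "f1 u = P * (1 + exp (\<kappa> * u) / q (exp (\<kappa> * u)))" for u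
  define f2 where "f2 u = 2 * m * exp (- (7 * \<kappa> * u / 8))" for u
  have split: "ennreal (m / q (exp (\<kappa> * u)) * exp (\<kappa> * u / 8)) * indicator {0..} u
      \<le> ennreal (f1 u) * indicator {0..U} u + ennreal (f2 u) * indicator {U..} u" for u
  proof -
    consider "u < 0" | "0 \<le> u" "u \<le> U" | "u > U" by linarith
    then show ?thesis
    proof cases
      case 2
      have "m / q (exp (\<kappa> * u)) \<le> 1 + exp (\<kappa> * u) / q (exp (\<kappa> * u))"
        using mq[of "exp (\<kappa> * u)"] q0[of "exp (\<kappa> * u)"] by (simp add: field_simps)
      moreover have "exp (\<kappa> * u / 8) \<le> P"
        unfolding P[symmetric] using 2 k by simp
      ultimately have "m / q (exp (\<kappa> * u)) * exp (\<kappa> * u / 8) \<le> (1 + exp (\<kappa> * u) / q (exp (\<kappa> * u))) * P"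
        using m1 q0[of "exp (\<kappa> * u)"] by (intro mult_mono) auto
      then have "ennreal (m / q (exp (\<kappa> * u)) * exp (\<kappa> * u / 8)) \<le> ennreal (f1 u)"
        by (intro ennreal_leI) (simp add: f1_def mult.commute)
      then show ?thesis using 2 by (auto simp: indicator_def intro: order_trans)
    next
      case 3
      define r where "r = exp (\<kappa> * u)"
      have "2 * m \<le> r" unfolding r_def U(2)[symmetric] using 3 k by simp
      moreover have "r \<le> q r + m"
      proof -
        have "r - x \<le> q r" unfolding q_def by (rule real_le_rsqrt) (simp add: power2_commute)
        then show ?thesis using mx by simp
      qed
      ultimately have "r / 2 \<le> q r" by simp
      then have "m / q r \<le> m / (r / 2)"
        using m1 by (intro divide_left_mono) (auto simp: r_def intro!: mult_pos_pos less_le_trans[OF _ q0])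
      then have "m / q r * exp (\<kappa> * u / 8) \<le> m / (r / 2) * exp (\<kappa> * u / 8)"
        by (rule mult_right_mono) simp
      also have "\<dots> = f2 u"
      proof -
        have "exp (\<kappa> * u / 8) / r = exp (- (7 * \<kappa> * u / 8))"
          unfolding r_def by (simp add: field_simps flip: exp_diff)
        then show ?thesis by (simp add: f2_def flip: times_divide_eq_right)
      qed
      finally have "ennreal (m / q (exp (\<kappa> * u)) * exp (\<kappa> * u / 8)) \<le> ennreal (f2 u)"
        unfolding r_def by (rule ennreal_leI)
      then show ?thesis using 3 U by (auto simp: indicator_def intro: order_trans)
    qed (auto simp: indicator_def)
  qed
  have I1: "(\<integral>\<^sup>+u. ennreal (f1 u) * indicator {0..U} u \<partial>lborel) \<le> ennreal (48 / \<kappa> * m powr (1 / 4))"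
  proof -
    \<comment> \<open>Since \<open>arsinh\<close> has derivative
      \<open>1 / sqrt (1 + z\<^sup>2)\<close>, the peak has an explicit antiderivative.\<close>
    define F where "F u = P * (u + arsinh (exp (\<kappa> * u) - x) / \<kappa>)" for u
    have "(\<integral>\<^sup>+u. ennreal (f1 u) * indicator {0..U} u \<partial>lborel) = ennreal (F U - F 0)"
    proof (rule nn_integral_FTC_Icc)
      show "f1 \<in> borel_measurable borel"
        unfolding f1_def q_def by measurable
      show "(F has_real_derivative f1 u) (at u)" for u
      proof -
        have "((\<lambda>u. exp (\<kappa> * u) - x) has_real_derivative exp (\<kappa> * u) * \<kappa>) (at u)"
          by (auto intro!: derivative_eq_intros)
        from DERIV_chain2[OF arsinh_real_has_field_derivative this]
        have "((\<lambda>u. arsinh (exp (\<kappa> * u) - x)) has_real_derivative exp (\<kappa> * u) * \<kappa> / q (exp (\<kappa> * u))) (at u)"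
          by (simp add: q_def power2_commute add.commute)
        from DERIV_cmult[OF DERIV_add[OF DERIV_ident DERIV_cdivide[OF this, of \<kappa>]], of P]
        show ?thesis
          unfolding F_def f1_def using k by simp
      qed
      show "0 \<le> f1 u" for u
        using q0[of "exp (\<kappa> * u)"] by (auto simp: f1_def P_def intro!: mult_nonneg_nonneg add_nonneg_nonneg)
    qed (rule U)
    also have "F U - F 0 = P * (U + (arsinh (2 * m - x) + arsinh (x - 1)) / \<kappa>)"
    proof -
      have "F U = P * (U + arsinh (2 * m - x) / \<kappa>)" by (simp only: F_def U(2))
      moreover have "F 0 = - (P * (arsinh (x - 1) / \<kappa>))"
        using arsinh_minus_real[of "x - 1"] by (simp add: F_def)
      ultimately show ?thesis by (simp add: algebra_simps add_divide_distrib)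
    qed
    also have "\<dots> \<le> P * (ln (5 * m) / \<kappa> + (ln (5 * m) + ln (5 * m)) / \<kappa>)"
      unfolding U_def using m1 mx x k
      by (intro mult_left_mono add_mono divide_right_mono arsinh_le_ln) (auto simp: P_def)
    also have "\<dots> = 3 / \<kappa> * (P * ln (5 * m))" by (simp add: field_simps)
    also have "\<dots> \<le> 3 / \<kappa> * (16 * m powr (1 / 4))"
    proof (intro mult_left_mono)
      \<comment> \<open>The logarithm is traded for a power \<open>1/8\<close>; with the
        \<open>1/8\<close> already in \<open>P\<close> this gives the exponent
        \<open>1/4\<close>.\<close>
      have "ln (5 * m) = 8 * ln ((5 * m) powr (1 / 8))" using m1 by (simp add: ln_powr)
      also have "\<dots> \<le> 8 * (5 * m) powr (1 / 8)"
        using m1 ln_le_minus_one[of "(5 * m) powr (1 / 8)"] by simp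
      finally have "P * ln (5 * m) \<le> (5 * m) powr (1 / 8) * (8 * (5 * m) powr (1 / 8))"
        unfolding P_def using m1 by (intro mult_mono powr_mono2) auto
      also have "\<dots> = 8 * (5 powr (1 / 4) * m powr (1 / 4))"
      proof -
        have "(5 * m) powr (1 / 8) * (5 * m) powr (1 / 8) = (5 * m) powr (1 / 4)"
          by (simp flip: powr_add)
        also have "\<dots> = 5 powr (1 / 4) * m powr (1 / 4)" by (rule powr_mult)
        finally show ?thesis by simp
      qed
      also have "\<dots> \<le> 8 * (2 * m powr (1 / 4))"
      proof -
        have "5 powr (1 / 4) \<le> (16::real) powr (1 / 4)" by (rule powr_mono2) auto
        also have "(16::real) powr (1 / 4) = 2"
          using powr_powr[of 2 4 "1/4"] by simp
        finally show ?thesis by (intro mult_left_mono mult_right_mono) auto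
      qed
      finally show "P * ln (5 * m) \<le> 16 * m powr (1 / 4)" by simp
    qed (use k in auto)
    also have "\<dots> = 48 / \<kappa> * m powr (1 / 4)" by simp
    finally show ?thesis by (simp add: ennreal_leI)
  qed
  have I2: "(\<integral>\<^sup>+u. ennreal (f2 u) * indicator {U..} u \<partial>lborel) \<le> ennreal (3 / \<kappa> * m powr (1 / 4))"
  proof -
    define F where "F u = - (16 * m / (7 * \<kappa>)) * exp (- (7 * \<kappa> * u / 8))" for u
    have "(\<integral>\<^sup>+u. ennreal (f2 u) * indicator {U..} u \<partial>lborel) = ennreal (0 - F U)"
    proof (rule nn_integral_FTC_atLeast)
      show "f2 \<in> borel_measurable borel"
        unfolding f2_def by measurable
      show "(F has_real_derivative f2 u) (at u)" for u
        unfolding F_def f2_def using k by (auto intro!: derivative_eq_intros)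
      show "0 \<le> f2 u" for u using m1 by (simp add: f2_def)
      show "(F \<longlongrightarrow> 0) at_top"
        unfolding F_def using k by real_asymp
    qed
    also have "0 - F U = 16 * m / (7 * \<kappa>) * (P / (2 * m))"
    proof -
      have "exp (- (7 * \<kappa> * U / 8)) = exp (\<kappa> * U / 8) / exp (\<kappa> * U)"
        by (simp add: field_simps flip: exp_diff)
      then show ?thesis unfolding F_def P U by simp
    qed
    also have "\<dots> = 8 / 7 / \<kappa> * P" using m1 by (simp add: field_simps)
    also have "\<dots> \<le> 8 / 7 / \<kappa> * (2 * m powr (1 / 4))"
    proof (intro mult_left_mono)
      have "P = 2 powr (1 / 8) * m powr (1 / 8)" using m1 by (simp add: P_def powr_mult)
      also have "\<dots> \<le> 2 powr 1 * m powr (1 / 4)"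
        using m1 by (intro mult_mono powr_mono) auto
      finally show "P \<le> 2 * m powr (1 / 4)" by simp
    qed (use k in auto)
    also have "\<dots> = 16 / 7 / \<kappa> * m powr (1 / 4)" by simp
    also have "\<dots> \<le> 3 / \<kappa> * m powr (1 / 4)"
      using k by (intro mult_right_mono divide_right_mono) auto
    finally show ?thesis by (simp add: ennreal_leI)
  qed
  have "(\<integral>\<^sup>+u. ennreal (m / q (exp (\<kappa> * u)) * exp (\<kappa> * u / 8)) * indicator {0..} u \<partial>lborel)
      \<le> (\<integral>\<^sup>+u. ennreal (f1 u) * indicator {0..U} u + ennreal (f2 u) * indicator {U..} u \<partial>lborel)"
    by (rule nn_integral_mono) (rule split)
  also have "\<dots> = (\<integral>\<^sup>+u. ennreal (f1 u) * indicator {0..U} u \<partial>lborel) + (\<integral>\<^sup>+u. ennreal (f2 u) * indicator {U..} u \<partial>lborel)"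
    unfolding f1_def f2_def q_def by (rule nn_integral_add) measurable
  also have "\<dots> \<le> ennreal (48 / \<kappa> * m powr (1 / 4)) + ennreal (3 / \<kappa> * m powr (1 / 4))"
    by (rule add_mono[OF I1 I2])
  also have "\<dots> = ennreal (51 / \<kappa> * m powr (1 / 4))"
    using k by (subst ennreal_plus[symmetric]) (auto simp: field_simps)
  finally show ?thesis by (simp add: q_def)
qed

section \<open>Decay of the Airy product and of the kernel\<close>

text \<open>The first summand comes from \<open>t < - y / 2\<close>, where the integral over
  \<open>t\<close> has growth to spare; the second from all other \<open>t\<close>, where the Airy
  argument \<open>y + t\<close> is at least \<open>y / 2\<close>.\<close>

definition edge_decay :: "real \<Rightarrow> real \<Rightarrow> real" where
  "edge_decay \<kappa> y = exp (- (\<kappa> * y / 32)) + exp (- (y * sqrt y / 8))"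

text \<open>Records decay only; growth at negative arguments is carried by a separate factor
  \<open>exp (e * max 0 (- a))\<close>.\<close>

definition airy_decay :: "real \<Rightarrow> real" where
  "airy_decay a = (if a \<ge> 0 then exp (- (a * sqrt a / 2)) else 1)"

lemma mult_sqrt_mono: "0 \<le> a \<Longrightarrow> a \<le> b \<Longrightarrow> a * sqrt a \<le> b * sqrt b"
  by (intro mult_mono) auto

text \<open>Replaces part of an exponent of order \<open>3/2\<close> by a linear one, which can be
  integrated explicitly.\<close>

lemma minus_1_le_mult_sqrt:
  assumes "t \<ge> 0"
  shows "t - 1 \<le> t * sqrt t"
proof (cases "t \<ge> 1")
  case True
  then have "t * 1 \<le> t * sqrt t" by (intro mult_left_mono) auto
  then show ?thesis by simp
next
  case False
  moreover have "0 \<le> t * sqrt t" using assms by simp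
  ultimately show ?thesis by linarith
qed

text \<open>For \<open>t \<ge> 0\<close> the Airy exponent is shared between \<open>y\<close> and
  \<open>t\<close>. For \<open>t = - u\<close> with \<open>u \<le> y / 2\<close>, the argument is
  still at least \<open>y / 2\<close>. For larger \<open>u\<close>, the gap between
  \<open>exp (\<kappa> * u / 16)\<close> and \<open>exp (\<kappa> * u / 8)\<close> pays for
  \<open>exp (- \<kappa> * y / 32)\<close>.\<close>

lemma exp_airy_decay_le:
  fixes \<kappa> t y :: real
  assumes k: "\<kappa> > 0" and y: "y \<ge> 0"
  shows "exp (\<kappa> * max 0 (- t) / 16) * airy_decay (y + t)
    \<le> edge_decay \<kappa> y * (if t \<ge> 0 then 2 * exp (- t / 4) else exp (- (\<kappa> * t) / 8))"
proof (cases "t \<ge> 0")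
  case True
  have "t - 1 \<le> t * sqrt t" using True by (rule minus_1_le_mult_sqrt)
  moreover have "t * sqrt t \<le> (y + t) * sqrt (y + t)" "y * sqrt y \<le> (y + t) * sqrt (y + t)"
    using True y by (intro mult_sqrt_mono; simp)+
  moreover have "0 \<le> y * sqrt y" using y by simp
  ultimately have "- ((y + t) * sqrt (y + t) / 2) \<le> - (y * sqrt y / 8) + (1 / 4 + - t / 4)"
    by linarith
  then have "airy_decay (y + t) \<le> exp (- (y * sqrt y / 8) + (1 / 4 + - t / 4))"
    using True y by (simp add: airy_decay_def)
  also have "\<dots> = exp (- (y * sqrt y / 8)) * (exp (1 / 4) * exp (- t / 4))"
    by (simp only: exp_add)
  also have "\<dots> \<le> edge_decay \<kappa> y * (2 * exp (- t / 4))"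
  proof (intro mult_mono)
    have "exp (1 / 4 :: real) \<le> exp (1 / 2)" by simp
    then show "exp (1 / 4 :: real) \<le> 2" using exp_half_le2 by linarith
  qed (auto simp: edge_decay_def)
  finally show ?thesis using True by simp
next
  case False
  define u where "u = - t"
  have u: "u > 0" "max 0 (- t) = u" "y + t = y - u" using False by (simp_all add: u_def)
  have "exp (\<kappa> * u / 16) * airy_decay (y - u) \<le> edge_decay \<kappa> y * exp (\<kappa> * u / 8)"
  proof (cases "u \<le> y / 2")
    case True
    have "sqrt y / 2 \<le> sqrt (y / 2)"
    proof (rule real_le_rsqrt)
      show "(sqrt y / 2)\<^sup>2 \<le> y / 2" using y by (simp add: power_divide)
    qed
    then have "(y / 2) * (sqrt y / 2) \<le> (y / 2) * sqrt (y / 2)"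
      using y by (intro mult_left_mono) auto
    also have "\<dots> \<le> (y - u) * sqrt (y - u)"
      using True y by (intro mult_sqrt_mono) auto
    finally have "airy_decay (y - u) \<le> exp (- (y * sqrt y / 8))"
      using True y u by (simp add: airy_decay_def)
    moreover have "exp (\<kappa> * u / 16) \<le> exp (\<kappa> * u / 8)"
      using k u by simp
    ultimately have "exp (\<kappa> * u / 16) * airy_decay (y - u) \<le> exp (\<kappa> * u / 8) * exp (- (y * sqrt y / 8))"
      by (intro mult_mono) (auto simp: airy_decay_def)
    then show ?thesis by (simp add: edge_decay_def algebra_simps add_increasing2)
  next
    case False
    have "airy_decay (y - u) \<le> 1" by (auto simp: airy_decay_def)
    then have "exp (\<kappa> * u / 16) * airy_decay (y - u) \<le> exp (\<kappa> * u / 16) * 1"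
      by (intro mult_left_mono) auto
    also have "\<dots> \<le> exp (- (\<kappa> * y / 32)) * exp (\<kappa> * u / 8)"
    proof -
      have "\<kappa> * (y / 2) \<le> \<kappa> * u" using False k by (intro mult_left_mono) auto
      then show ?thesis by (simp flip: exp_add)
    qed
    finally show ?thesis by (simp add: edge_decay_def algebra_simps add_increasing)
  qed
  then show ?thesis using False unfolding u by (simp add: u_def)
qed

text \<open>The line goes through the saddle point \<open>sqrt a\<close> of
  \<open>d ^ 3 / 3 - a * d\<close>, or through \<open>e\<close> if the saddle lies to the left of
  \<open>e\<close> or \<open>a\<close> is negative. The exponent at the saddle is
  \<open>- 2/3 * a powr (3/2)\<close>; lowering \<open>2/3\<close> to \<open>1/2\<close> absorbs the
  factor \<open>1 + d\<close>.\<close>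

lemma cmod_Ai_Gamma_lower_decay:
  assumes e: "0 < e" "e \<le> 1"
  obtains C where "C > 0"
    "\<And>a b. 0 < b \<Longrightarrow> b \<le> b0 \<Longrightarrow>
      cmod (Ai_Gamma_lower a b 0) \<le> b * C * exp (e * max 0 (- a)) * airy_decay a"
proof -
  obtain C where C: "C > 0" "\<And>a b d. 0 < b \<Longrightarrow> b \<le> b0 \<Longrightarrow> e \<le> d \<Longrightarrow>
      cmod (Ai_Gamma_lower a b 0) \<le> b * C * (1 + d) * exp (d ^ 3 / 3 - a * d)"
    using cmod_Ai_Gamma_lower_le[OF e, of b0] by blast
  have "cmod (Ai_Gamma_lower a b 0) \<le> b * (C * exp 2) * exp (e * max 0 (- a)) * airy_decay a"
    if b: "0 < b" "b \<le> b0" for a b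
  proof -
    have main: ?thesis if d: "e \<le> d" and le: "d + d ^ 3 / 3 - a * d \<le> 2 + e * max 0 (- a) + ln (airy_decay a)" for d
    proof -
      have "cmod (Ai_Gamma_lower a b 0) \<le> b * C * (1 + d) * exp (d ^ 3 / 3 - a * d)"
        by (rule C(2)[OF b d])
      also have "\<dots> \<le> b * C * exp d * exp (d ^ 3 / 3 - a * d)"
        using b C by (intro mult_right_mono mult_left_mono) auto
      also have "\<dots> = b * C * exp (d + d ^ 3 / 3 - a * d)"
        by (simp flip: exp_add add: algebra_simps)
      also have "\<dots> \<le> b * C * exp (2 + e * max 0 (- a) + ln (airy_decay a))"
        using b C le by (intro mult_left_mono) auto
      also have "\<dots> = b * (C * exp 2) * exp (e * max 0 (- a)) * airy_decay a"
        by (simp add: exp_add airy_decay_def)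
      finally show ?thesis .
    qed
    have e3: "e ^ 3 \<le> 1" using e by (intro power_le_one) auto
    consider "a < 0" | "0 \<le> a" "sqrt a \<le> e" | "0 \<le> a" "e \<le> sqrt a" by linarith
    then show ?thesis
    proof cases
      case 1
      then show ?thesis using e e3 by (intro main[of e]) (auto simp: airy_decay_def max_def)
    next
      case 2
      have "sqrt a \<le> 1" using 2 e by linarith
      then have "a * sqrt a \<le> 1" using 2 mult_mono[of a 1 "sqrt a" 1] by simp
      moreover have "0 \<le> a * e" using 2 e by simp
      moreover have "ln (airy_decay a) = - (a * sqrt a / 2)" "e * max 0 (- a) = 0"
        using 2 by (simp_all add: airy_decay_def)
      ultimately show ?thesis using e e3 by (intro main[of e]) linarith+
    next
      case 3
      define w where "w = sqrt a"
      have w: "w \<ge> 0" "a = w\<^sup>2" using 3 by (simp_all add: w_def)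
      \<comment> \<open>A cubic with double root \<open>3/2\<close> yields
        \<open>w \<le> 2 + w ^ 3 / 6\<close>, exactly the gap between \<open>2/3\<close> and
        \<open>1/2\<close>.\<close>
      have "0 \<le> (w - 3 / 2)\<^sup>2 * (w + 3)" using w by simp
      moreover have "(w - 3 / 2)\<^sup>2 * (w + 3) = w ^ 3 - 27 / 4 * w + 27 / 4"
        by (simp add: power2_eq_square power3_eq_cube algebra_simps)
      ultimately have "w + w ^ 3 / 3 - w ^ 3 \<le> 2 - w ^ 3 / 2"
        using w(1) by linarith
      moreover have "a * sqrt a = w ^ 3" unfolding w_def[symmetric] using w by (simp add: power2_eq_square power3_eq_cube)
      ultimately show ?thesis using 3
        by (intro main[of w]) (auto simp: airy_decay_def w_def[symmetric])
    qed
  qed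
  then show ?thesis using that[of "C * exp 2"] C(1) by simp
qed

lemma kappa_mono: "0 < S \<Longrightarrow> S \<le> T \<Longrightarrow> kappa S \<le> kappa T"
  unfolding kappa_def by (intro mult_left_mono powr_mono2) auto

lemma kappa_pos: "T > 0 \<Longrightarrow> kappa T > 0"
  by (simp add: kappa_def)

text \<open>The factors \<open>1 / b\<close> and \<open>b\<close> of the two Airy bounds cancel,
  which makes the estimate uniform in \<open>T\<close>. The upper function gives no decay in
  \<open>X\<close>, so the decay is in \<open>Y\<close> alone.\<close>

lemma cmod_Ai_Gamma_product_le:
  assumes T0: "T0 > 0"
  obtains D where "D > 0"
    "\<And>T X Y t. T \<ge> T0 \<Longrightarrow> X \<ge> 0 \<Longrightarrow> Y \<ge> 0 \<Longrightarrow>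
      cmod (Ai_Gamma_upper (X + t) (1 / kappa T) 0 * Ai_Gamma_lower (Y + t) (1 / kappa T) 0)
        \<le> D * edge_decay (kappa T) Y * (if t \<ge> 0 then 2 * exp (- t / 4) else exp (- (kappa T * t) / 8))"
proof -
  define k0 where "k0 = kappa T0"
  \<comment> \<open>Since \<open>32 * e \<le> k0 \<le> k\<close>, the two growth factors
    \<open>exp (e * n)\<close> together stay below \<open>exp (k * n / 16)\<close>; \<open>e\<close>
    is also small enough to keep the shifted line between the first two poles.\<close>
  define e where "e = min 1 k0 / 32"
  have k0: "k0 > 0" using T0 by (simp add: k0_def kappa_pos)
  have e: "0 < e" "e \<le> 1" "e * (1 / k0) \<le> 1 / 2" "32 * e \<le> k0"
    using k0 by (auto simp: e_def min_def field_simps)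
  obtain A where A: "A > 0" "\<And>a b. 0 < b \<Longrightarrow> b \<le> 1 / k0 \<Longrightarrow>
      cmod (Ai_Gamma_upper a b 0) \<le> A / b * (1 + exp (- e * a))"
    using cmod_Ai_Gamma_upper_le[OF e(1-3)] by blast
  obtain B where B: "B > 0" "\<And>a b. 0 < b \<Longrightarrow> b \<le> 1 / k0 \<Longrightarrow>
      cmod (Ai_Gamma_lower a b 0) \<le> b * B * exp (e * max 0 (- a)) * airy_decay a"
    using cmod_Ai_Gamma_lower_decay[OF e(1,2)] by blast
  have "cmod (Ai_Gamma_upper (X + t) (1 / kappa T) 0 * Ai_Gamma_lower (Y + t) (1 / kappa T) 0)
        \<le> 2 * A * B * edge_decay (kappa T) Y * (if t \<ge> 0 then 2 * exp (- t / 4) else exp (- (kappa T * t) / 8))"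
    if T: "T \<ge> T0" and X: "X \<ge> 0" and Y: "Y \<ge> 0" for T X Y t
  proof -
    define k where "k = kappa T"
    define n where "n = max 0 (- t)"
    have k: "k > 0" "k0 \<le> k"
      using T T0 kappa_mono[of T0 T] k0 by (auto simp: k_def k0_def)
    have b: "0 < 1 / k" "1 / k \<le> 1 / k0" using k k0 by (auto simp: field_simps)
    have up: "cmod (Ai_Gamma_upper (X + t) (1 / k) 0) \<le> A / (1 / k) * (2 * exp (e * n))"
    proof (rule order_trans[OF A(2)[OF b]], intro mult_left_mono)
      have "- (X + t) \<le> n" using X by (simp add: n_def)
      then have "e * - (X + t) \<le> e * n" using e by (intro mult_left_mono) auto
      then have "exp (- e * (X + t)) \<le> exp (e * n)" by (simp add: algebra_simps)
      moreover have "1 \<le> exp (e * n)" using e by (simp add: n_def)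
      ultimately show "1 + exp (- e * (X + t)) \<le> 2 * exp (e * n)" by linarith
    qed (use A k in auto)
    have low: "cmod (Ai_Gamma_lower (Y + t) (1 / k) 0) \<le> (1 / k) * B * exp (e * n) * airy_decay (Y + t)"
    proof (rule order_trans[OF B(2)[OF b]], intro mult_right_mono mult_left_mono)
      show "exp (e * max 0 (- (Y + t))) \<le> exp (e * n)" using Y e by (auto simp: n_def)
    qed (use B k in \<open>auto simp: airy_decay_def\<close>)
    have "cmod (Ai_Gamma_upper (X + t) (1 / k) 0 * Ai_Gamma_lower (Y + t) (1 / k) 0)
        \<le> (A / (1 / k) * (2 * exp (e * n))) * ((1 / k) * B * exp (e * n) * airy_decay (Y + t))"
      unfolding norm_mult using A k by (intro mult_mono up low) auto
    also have "\<dots> = 2 * A * B * (exp (e * n) * exp (e * n) * airy_decay (Y + t))"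
      using k by simp
    also have "\<dots> \<le> 2 * A * B * (exp (k * n / 16) * airy_decay (Y + t))"
    proof (intro mult_left_mono mult_right_mono)
      have "32 * e * n \<le> k * n" using e k by (intro mult_right_mono) (auto simp: n_def)
      then have "e * n + e * n \<le> k * n / 16" by simp
      then show "exp (e * n) * exp (e * n) \<le> exp (k * n / 16)" by (simp flip: exp_add)
    qed (use A B in \<open>auto simp: airy_decay_def\<close>)
    also have "\<dots> \<le> 2 * A * B * (edge_decay k Y * (if t \<ge> 0 then 2 * exp (- t / 4) else exp (- (k * t) / 8)))"
      using exp_airy_decay_le[OF k(1) Y, of t] A B unfolding n_def by (intro mult_left_mono) auto
    finally show ?thesis by (simp only: k_def mult.assoc)
  qed
  moreover have "2 * A * B > 0" using A B by simp
  ultimately show ?thesis using that by blast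
qed

text \<open>Only the growth exponent in \<open>m\<close>, which must stay below \<open>1/2\<close>, matters here: Hadamard's
  inequality turns \<open>m powr p\<close> into a determinant of size \<open>exp (m powr (2 p))\<close>, which the factor
  \<open>exp (- \<mu>)\<close> has to absorb.\<close>
lemma cmod_K_edge_le:
  assumes T0: "T0 > 0"
  obtains D where "D > 0"
    "\<And>T X Y x \<mu>. T \<ge> T0 \<Longrightarrow> X \<ge> 0 \<Longrightarrow> Y \<ge> 0 \<Longrightarrow> x \<ge> 0 \<Longrightarrow> cmod \<mu> \<le> sqrt (1 + x\<^sup>2) \<Longrightarrow>
      (\<And>r. r \<ge> 0 \<Longrightarrow> sqrt (1 + (x - r)\<^sup>2) \<le> cmod (\<mu> - of_real r)) \<Longrightarrow>
      cmod (K_edge T \<mu> X Y) \<le> D * edge_decay (kappa T) Y * sqrt (1 + x\<^sup>2) powr (1 / 4)"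
proof -
  obtain D where D: "D > 0" "\<And>T X Y t. T \<ge> T0 \<Longrightarrow> X \<ge> 0 \<Longrightarrow> Y \<ge> 0 \<Longrightarrow>
      cmod (Ai_Gamma_upper (X + t) (1 / kappa T) 0 * Ai_Gamma_lower (Y + t) (1 / kappa T) 0)
        \<le> D * edge_decay (kappa T) Y * (if t \<ge> 0 then 2 * exp (- t / 4) else exp (- (kappa T * t) / 8))"
    using cmod_Ai_Gamma_product_le[OF T0] by blast
  \<comment> \<open>\<open>16\<close> is the integral over \<open>t \<ge> 0\<close>, and
    \<open>51 / kappa T0\<close> dominates the one over \<open>t < 0\<close> for every
    \<open>T \<ge> T0\<close>.\<close>
  define D' where "D' = D * (16 + 51 / kappa T0)"
  have "cmod (K_edge T \<mu> X Y) \<le> D' * edge_decay (kappa T) Y * sqrt (1 + x\<^sup>2) powr (1 / 4)"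
    if T: "T \<ge> T0" and XY: "X \<ge> 0" "Y \<ge> 0" and x: "x \<ge> 0" and mu: "cmod \<mu> \<le> sqrt (1 + x\<^sup>2)"
      and mur: "\<And>r. r \<ge> 0 \<Longrightarrow> sqrt (1 + (x - r)\<^sup>2) \<le> cmod (\<mu> - of_real r)" for T X Y x \<mu>
  proof -
    define k where "k = kappa T"
    have k0: "kappa T0 > 0" using T0 by (rule kappa_pos)
    have k: "k > 0" "kappa T0 \<le> k"
      using T T0 kappa_mono[of T0 T] k0 by (auto simp: k_def)
    define m where "m = sqrt (1 + x\<^sup>2)"
    define q where "q r = sqrt (1 + (x - r)\<^sup>2)" for r
    have m1: "m \<ge> 1" by (simp add: m_def)
    have q1: "q r \<ge> 1" for r by (simp add: q_def)
    define E where "E = edge_decay k Y"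
    have E0: "E \<ge> 0" by (simp add: E_def edge_decay_def)
    define g where "g t = \<mu> / (\<mu> - of_real (exp (- kappa T * t)))
        * Ai_Gamma_upper (X + t) (1 / kappa T) 0 * Ai_Gamma_lower (Y + t) (1 / kappa T) 0" for t
    \<comment> \<open>For \<open>t \<ge> 0\<close> the point \<open>exp (- k * t)\<close> is at most
      \<open>1\<close>, so the weight is at most \<open>2\<close>; negative \<open>t\<close> are
      reflected to \<open>u = - t\<close> and handled by \<open>h2\<close>.\<close>
    define h1 where "h1 t = 4 * exp (- t / 4)" for t :: real
    define h2 where "h2 u = m / q (exp (k * u)) * exp (k * u / 8)" for u
    have W: "cmod (\<mu> / (\<mu> - of_real (exp (- kappa T * t)))) \<le> m / q (exp (- k * t))" for t
      unfolding norm_divide using mu mur[of "exp (- k * t)"] q1[of "exp (- k * t)"] m1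
      by (intro frac_le) (auto simp: m_def q_def k_def add_pos_nonneg)
    have gle: "cmod (g t) \<le> m / q (exp (- k * t)) * (D * E * (if t \<ge> 0 then 2 * exp (- t / 4) else exp (- (k * t) / 8)))" for t
      unfolding g_def mult.assoc norm_mult[of "\<mu> / _"]
      using W[of t] D(2)[OF T XY, of t] m1 q1[of "exp (- k * t)"]
      by (intro mult_mono) (auto simp: k_def E_def mult.assoc)
    have le: "ennreal (cmod (g t)) \<le> ennreal (D * E) * (ennreal (h1 t) * indicator {0..} t + ennreal (h2 (- t)) * indicator {0..} (- t))" for t
    proof (cases "t \<ge> 0")
      case True
      have "exp (- k * t) \<le> 1" using True k by simp
      then have "m \<le> 2 * q (exp (- k * t))"
        using weight_le_1_plus[OF x exp_ge_zero, of "- k * t", folded m_def q_def] q1[of "exp (- k * t)"]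
        by linarith
      then have "m / q (exp (- k * t)) \<le> 2"
        using q1[of "exp (- k * t)"] by (simp add: divide_le_eq)
      then have "m / q (exp (- k * t)) * (D * E * (2 * exp (- t / 4))) \<le> 2 * (D * E * (2 * exp (- t / 4)))"
        using D E0 by (intro mult_right_mono) auto
      then have "cmod (g t) \<le> D * E * h1 t" using gle[of t] True by (simp add: h1_def)
      then have "ennreal (cmod (g t)) \<le> ennreal (D * E) * ennreal (h1 t)"
        using D E0 by (subst ennreal_mult[symmetric]) (auto simp: h1_def intro!: ennreal_leI)
      also have "\<dots> \<le> ennreal (D * E) * (ennreal (h1 t) * indicator {0..} t + ennreal (h2 (- t)) * indicator {0..} (- t))"
        using True by (intro mult_left_mono) auto
      finally show ?thesis .
    next
      case False
      then have "cmod (g t) \<le> D * E * h2 (- t)" using gle[of t] by (simp add: h2_def mult_ac)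
      then have "ennreal (cmod (g t)) \<le> ennreal (D * E) * ennreal (h2 (- t))"
        using D E0 m1 q1 by (subst ennreal_mult[symmetric])
          (auto simp: h2_def intro!: ennreal_leI divide_nonneg_nonneg intro: order_trans[OF zero_le_one])
      then show ?thesis using False by simp
    qed
    have I1: "(\<integral>\<^sup>+t. ennreal (h1 t) * indicator {0..} t \<partial>lborel) = ennreal 16"
    proof -
      have "(\<integral>\<^sup>+t. ennreal (h1 t) * indicator {0..} t \<partial>lborel) = ennreal (0 - (- 16 * exp (- 0 / 4)))"
      proof (rule nn_integral_FTC_atLeast)
        show "((\<lambda>t. - 16 * exp (- t / 4)) has_real_derivative h1 t) (at t)" for t
          unfolding h1_def by (auto intro!: derivative_eq_intros)
        show "((\<lambda>t::real. - 16 * exp (- t / 4)) \<longlongrightarrow> 0) at_top" by real_asymp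
      qed (auto simp: h1_def)
      then show ?thesis by simp
    qed
    have I2: "(\<integral>\<^sup>+t. ennreal (h2 (- t)) * indicator {0..} (- t) \<partial>lborel) \<le> ennreal (51 / k * m powr (1 / 4))"
    proof -
      have "(\<integral>\<^sup>+t. ennreal (h2 t) * indicator {0..} t \<partial>lborel)
          = ennreal \<bar>- 1\<bar> * (\<integral>\<^sup>+t. ennreal (h2 (0 + - 1 * t)) * indicator {0..} (0 + - 1 * t) \<partial>lborel)"
        unfolding h2_def q_def
        by (rule nn_integral_real_affine) auto
      moreover have "(\<integral>\<^sup>+t. ennreal (h2 t) * indicator {0..} t \<partial>lborel) \<le> ennreal (51 / k * m powr (1 / 4))"
        unfolding h2_def q_def m_def by (rule nn_integral_weight_le[OF x k(1)])
      ultimately show ?thesis by simp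
    qed
    have "cmod (integral\<^sup>L lborel g) \<le> D * E * (16 + 51 / k * m powr (1 / 4))"
    proof (rule norm_lebesgue_integral_le)
      have "(\<integral>\<^sup>+t. ennreal (cmod (g t)) \<partial>lborel) \<le> (\<integral>\<^sup>+t. ennreal (D * E) *
          (ennreal (h1 t) * indicator {0..} t + ennreal (h2 (- t)) * indicator {0..} (- t)) \<partial>lborel)"
        by (rule nn_integral_mono) (rule le)
      also have "\<dots> = ennreal (D * E) * (\<integral>\<^sup>+t. ennreal (h1 t) * indicator {0..} t + ennreal (h2 (- t)) * indicator {0..} (- t) \<partial>lborel)"
        unfolding h1_def h2_def q_def by (rule nn_integral_cmult) measurable
      also have "(\<integral>\<^sup>+t. ennreal (h1 t) * indicator {0..} t + ennreal (h2 (- t)) * indicator {0..} (- t) \<partial>lborel)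
          = (\<integral>\<^sup>+t. ennreal (h1 t) * indicator {0..} t \<partial>lborel) + (\<integral>\<^sup>+t. ennreal (h2 (- t)) * indicator {0..} (- t) \<partial>lborel)"
        unfolding h1_def h2_def q_def by (rule nn_integral_add) measurable
      also have "\<dots> \<le> ennreal 16 + ennreal (51 / k * m powr (1 / 4))"
        using I1 I2 by (intro add_mono) auto
      also have "\<dots> = ennreal (16 + 51 / k * m powr (1 / 4))"
        using k by (subst ennreal_plus) auto
      also have "ennreal (D * E) * \<dots> = ennreal (D * E * (16 + 51 / k * m powr (1 / 4)))"
        using D E0 k by (subst ennreal_mult) auto
      finally show "(\<integral>\<^sup>+t. ennreal (cmod (g t)) \<partial>lborel) \<le> ennreal (D * E * (16 + 51 / k * m powr (1 / 4)))"
        by (simp add: mult_left_mono)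
    qed (use D E0 k in auto)
    also have "\<dots> \<le> D * E * (16 * m powr (1 / 4) + 51 / kappa T0 * m powr (1 / 4))"
    proof (intro mult_left_mono add_mono mult_right_mono)
      show "16 \<le> 16 * m powr (1 / 4)" using m1 ge_one_powr_ge_zero[of m "1/4"] by simp
      show "51 / k \<le> 51 / kappa T0" using k k0 by (simp add: frac_le)
    qed (use D E0 in auto)
    finally show ?thesis
      unfolding K_edge_def g_def[abs_def] by (simp add: D'_def E_def k_def m_def algebra_simps)
  qed
  moreover have "D' > 0" using D kappa_pos[OF T0] by (simp add: D'_def add_pos_pos)
  ultimately show ?thesis using that by blast
qed

subsection \<open>The tail of the distribution\<close>

text \<open>Halved so as not to exceed \<open>1\<close>, as required of the small parameter in the
  determinant bound. The rate \<open>1/16\<close> is half that of \<open>edge_decay\<close>; the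
  other half is spent on integrating.\<close>

definition edge_tail :: "real \<Rightarrow> real \<Rightarrow> real" where
  "edge_tail \<kappa> s = (exp (- (\<kappa> * s / 32)) + exp (- (s * sqrt s / 16))) / 2"

text \<open>Half of the exponent \<open>y * sqrt y / 8\<close> is evaluated at \<open>s\<close>, the
  other half is bounded linearly; the majorant \<open>f\<close> then has an elementary
  antiderivative.\<close>

lemma nn_integral_edge_decay_le:
  fixes \<kappa> k0 s :: real
  assumes "0 < k0" "k0 \<le> \<kappa>" and s: "0 \<le> s"
  shows "(\<integral>\<^sup>+y. ennreal (edge_decay \<kappa> y) * indicator {s<..} y \<partial>lborel)
    \<le> ennreal (64 * (1 / k0 + 1) * edge_tail \<kappa> s)"
proof -
  have k: "\<kappa> > 0" using assms by simp
  define f where "f y = exp (- (\<kappa> * y / 32)) + exp (- (s * sqrt s / 16)) * (2 * exp (- y / 16))" for y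
  define F where "F y = - 32 / \<kappa> * exp (- (\<kappa> * y / 32)) - exp (- (s * sqrt s / 16)) * (32 * exp (- y / 16))" for y
  have le: "edge_decay \<kappa> y \<le> f y" if "y \<ge> s" for y
  proof -
    have "s * sqrt s \<le> y * sqrt y" using s that by (intro mult_sqrt_mono)
    moreover have "y - 1 \<le> y * sqrt y" using s that by (intro minus_1_le_mult_sqrt) auto
    ultimately have "- (y * sqrt y / 8) \<le> - (s * sqrt s / 16) + (1 / 16 + - y / 16)" by linarith
    then have "exp (- (y * sqrt y / 8)) \<le> exp (- (s * sqrt s / 16)) * (exp (1 / 16) * exp (- y / 16))"
      by (simp only: exp_add[symmetric] exp_le_cancel_iff)
    also have "\<dots> \<le> exp (- (s * sqrt s / 16)) * (2 * exp (- y / 16))"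
    proof (intro mult_left_mono mult_right_mono)
      have "exp (1 / 16 :: real) \<le> exp (1 / 2)" by simp
      then show "exp (1 / 16 :: real) \<le> 2" using exp_half_le2 by linarith
    qed auto
    finally show ?thesis by (simp add: edge_decay_def f_def)
  qed
  have "(\<integral>\<^sup>+y. ennreal (edge_decay \<kappa> y) * indicator {s<..} y \<partial>lborel)
      \<le> (\<integral>\<^sup>+y. ennreal (f y) * indicator {s..} y \<partial>lborel)"
    by (intro nn_integral_mono) (auto simp: indicator_def intro!: ennreal_leI le)
  also have "\<dots> = ennreal (0 - F s)"
  proof (rule nn_integral_FTC_atLeast)
    show "(F has_real_derivative f y) (at y)" for y
      unfolding F_def f_def using k by (auto intro!: derivative_eq_intros)
    have "((\<lambda>y. - 32 / \<kappa> * exp (- (\<kappa> * y / 32))) \<longlongrightarrow> 0) at_top" "((\<lambda>y::real. 32 * exp (- y / 16)) \<longlongrightarrow> 0) at_top"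
      using k by real_asymp+
    from tendsto_diff[OF this(1) tendsto_mult_left[OF this(2), of "exp (- (s * sqrt s / 16))"]]
    show "(F \<longlongrightarrow> 0) at_top" by (simp add: F_def[abs_def])
  qed (auto simp: f_def)
  also have "0 - F s \<le> 64 * (1 / k0 + 1) * edge_tail \<kappa> s"
  proof -
    have "32 / \<kappa> \<le> 32 / k0" using assms by (intro frac_le) auto
    also have "\<dots> \<le> 32 * (1 / k0 + 1)" by (simp add: distrib_left)
    finally have "32 / \<kappa> \<le> 32 * (1 / k0 + 1)" .
    then have "32 / \<kappa> * exp (- (\<kappa> * s / 32)) \<le> 32 * (1 / k0 + 1) * exp (- (\<kappa> * s / 32))"
      by (rule mult_right_mono) simp
    moreover have "exp (- (s * sqrt s / 16)) * (32 * exp (- s / 16)) \<le> exp (- (s * sqrt s / 16)) * (32 * (1 / k0 + 1))"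
    proof (intro mult_left_mono)
      have "exp (- s / 16) \<le> 1" using s by simp
      also have "1 \<le> 1 / k0 + 1" using assms by simp
      finally show "exp (- s / 16) \<le> 1 / k0 + 1" .
    qed auto
    ultimately have "32 / \<kappa> * exp (- (\<kappa> * s / 32)) + exp (- (s * sqrt s / 16)) * (32 * exp (- s / 16))
      \<le> 32 * (1 / k0 + 1) * exp (- (\<kappa> * s / 32)) + exp (- (s * sqrt s / 16)) * (32 * (1 / k0 + 1))"
      by (rule add_mono)
    also have "\<dots> = 64 * (1 / k0 + 1) * edge_tail \<kappa> s"
    proof -
      have "32 * p * a + c * (32 * p) = 64 * p * ((a + c) / 2)" for p a c :: real
        by (simp add: algebra_simps)
      then show ?thesis unfolding edge_tail_def .
    qed
    finally show ?thesis by (simp add: F_def)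
  qed
  finally show ?thesis by (simp add: ennreal_leI)
qed

text \<open>The parameter \<open>x\<close> is the real part of \<open>\<mu>\<close> on the rays and
  \<open>0\<close> on the semicircle, so one estimate serves the whole contour. The growth
  \<open>exp (x / 2)\<close> uses only half of the decay of \<open>exp (- \<mu>)\<close>.\<close>

lemma fredholm_det_K_edge_le:
  assumes T0: "T0 > 0"
  obtains Q where "Q > 0"
    "\<And>T s x \<mu>. T \<ge> T0 \<Longrightarrow> s \<ge> 0 \<Longrightarrow> x \<ge> 0 \<Longrightarrow> cmod \<mu> \<le> sqrt (1 + x\<^sup>2) \<Longrightarrow>
      (\<And>r. r \<ge> 0 \<Longrightarrow> sqrt (1 + (x - r)\<^sup>2) \<le> cmod (\<mu> - of_real r)) \<Longrightarrow>
      cmod (fredholm_det (restrict_space lborel {s<..}) (K_edge_conj T \<mu>) - 1)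
        \<le> edge_tail (kappa T) s * (Q * exp (x / 2))"
proof -
  obtain D where D: "D > 0" "\<And>T X Y x \<mu>. T \<ge> T0 \<Longrightarrow> X \<ge> 0 \<Longrightarrow> Y \<ge> 0 \<Longrightarrow> x \<ge> 0 \<Longrightarrow> cmod \<mu> \<le> sqrt (1 + x\<^sup>2) \<Longrightarrow>
      (\<And>r. r \<ge> 0 \<Longrightarrow> sqrt (1 + (x - r)\<^sup>2) \<le> cmod (\<mu> - of_real r)) \<Longrightarrow>
      cmod (K_edge T \<mu> X Y) \<le> D * edge_decay (kappa T) Y * sqrt (1 + x\<^sup>2) powr (1 / 4)"
    using cmod_K_edge_le[OF T0] by blast
  define k0 where "k0 = kappa T0"
  have k0: "k0 > 0" using T0 by (simp add: k0_def kappa_pos)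
  define L where "L = 64 * (1 / k0 + 1)"
  have L: "L > 0" using k0 by (simp add: L_def add_pos_pos)
  define G where "G = 8 * (D * L)\<^sup>2"
  define Q where "Q = exp ((G\<^sup>2 + 1) / 2)"
  have "cmod (fredholm_det (restrict_space lborel {s<..}) (K_edge_conj T \<mu>) - 1)
        \<le> edge_tail (kappa T) s * (Q * exp (x / 2))"
    if T: "T \<ge> T0" and s: "s \<ge> 0" and x: "x \<ge> 0" and mu: "cmod \<mu> \<le> sqrt (1 + x\<^sup>2)"
      and mur: "\<And>r. r \<ge> 0 \<Longrightarrow> sqrt (1 + (x - r)\<^sup>2) \<le> cmod (\<mu> - of_real r)" for T s x \<mu>
  proof -
    define k where "k = kappa T"
    have k: "k0 \<le> k" using T T0 by (simp add: k_def k0_def kappa_mono)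
    define m where "m = sqrt (1 + x\<^sup>2)"
    have m1: "m \<ge> 1" by (simp add: m_def)
    define H where "H = D * m powr (1 / 4)"
    have H: "H > 0" using D m1 by (simp add: H_def)
    define M where "M = restrict_space (lborel :: real measure) {s<..}"
    \<comment> \<open>The conjugation weights are split between the two variables; they cancel in
      \<open>g y * h y\<close>, so they leave the determinant bound unaffected.\<close>
    define g where "g y = 1 / sqrt (y ^ 4 + 1)" for y :: real
    define h where "h y = H * edge_decay k y * sqrt (y ^ 4 + 1)" for y
    have y4: "sqrt (y ^ 4 + 1) > 0" for y :: real
      by (simp add: add_nonneg_pos)
    have spM: "space M = {s<..}" by (simp add: M_def space_restrict_space)
    have gh: "g y * h y = H * edge_decay k y" for y
      using y4[of y] by (simp add: g_def h_def)
    have sf: "sigma_finite_measure M"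
      unfolding M_def by (intro sigma_finite_measure_restrict_space) (auto intro: lborel.sigma_finite_measure_axioms)
    have "cmod (fredholm_det M (K_edge_conj T \<mu>) - 1) \<le> edge_tail k s * exp (8 * (H * L)\<^sup>2)"
    proof (rule norm_fredholm_det_minus_1_le[OF sf, where g = g and h = h])
      show "g y > 0" "h y > 0" for y
        using y4[of y] H by (auto simp: g_def h_def edge_decay_def intro!: mult_pos_pos add_pos_pos)
      show "cmod (K_edge_conj T \<mu> X Y) \<le> g X * h Y" if "X \<in> space M" "Y \<in> space M" for X Y
      proof -
        have XY: "X \<ge> 0" "Y \<ge> 0" using that s by (auto simp: spM)
        have "cmod (K_edge T \<mu> X Y) \<le> H * edge_decay k Y"
          using D(2)[OF T XY x mu mur] by (simp add: H_def m_def k_def mult_ac)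
        then have "g X * cmod (K_edge T \<mu> X Y) * sqrt (Y ^ 4 + 1) \<le> g X * (H * edge_decay k Y) * sqrt (Y ^ 4 + 1)"
          using y4 by (intro mult_right_mono mult_left_mono) (auto simp: g_def less_imp_le)
        moreover have "cmod (K_edge_conj T \<mu> X Y) = g X * cmod (K_edge T \<mu> X Y) * sqrt (Y ^ 4 + 1)"
          using y4[of X] y4[of Y] unfolding K_edge_conj_def norm_mult norm_of_real g_def by simp
        ultimately show ?thesis by (simp add: h_def mult.assoc)
      qed
      have meas: "edge_decay k \<in> borel_measurable borel"
        unfolding edge_decay_def by measurable
      then show "(\<lambda>y. g y * h y) \<in> borel_measurable M"
        unfolding gh M_def by (intro measurable_restrict_space1) measurable
      have "(\<integral>\<^sup>+y. ennreal (g y * h y) \<partial>M) = (\<integral>\<^sup>+y. ennreal H * (ennreal (edge_decay k y) * indicator {s<..} y) \<partial>lborel)"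
        unfolding gh M_def using H by (subst nn_integral_restrict_space)
          (auto simp: ennreal_mult edge_decay_def mult.assoc intro!: nn_integral_cong)
      also have "\<dots> = ennreal H * (\<integral>\<^sup>+y. ennreal (edge_decay k y) * indicator {s<..} y \<partial>lborel)"
        by (intro nn_integral_cmult borel_measurable_times_ennreal borel_measurable_indicator) (use meas in auto)
      also have "\<dots> \<le> ennreal H * ennreal (L * edge_tail k s)"
        unfolding L_def by (intro mult_left_mono nn_integral_edge_decay_le k0 k s) auto
      also have "\<dots> = ennreal (H * L * edge_tail k s)"
        using H L by (subst ennreal_mult[symmetric]) (auto simp: edge_tail_def mult.assoc)
      finally show "(\<integral>\<^sup>+y. ennreal (g y * h y) \<partial>M) \<le> ennreal (H * L * edge_tail k s)" .
      have "exp (- (k * s / 32)) + exp (- (s * sqrt s / 16)) \<le> 1 + 1"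
        using k k0 s by (intro add_mono) auto
      then show "edge_tail k s \<le> 1" by (simp add: edge_tail_def)
    qed (use H L in \<open>auto simp: edge_tail_def\<close>)
    also have "exp (8 * (H * L)\<^sup>2) \<le> Q * exp (x / 2)"
    proof -
      have "(m powr (1 / 4))\<^sup>2 = sqrt m"
        using m1 by (simp add: powr_half_sqrt power2_eq_square flip: powr_add)
      then have "8 * (H * L)\<^sup>2 = G * sqrt m"
        by (simp add: H_def G_def power_mult_distrib)
      \<comment> \<open>AM-GM makes the exponent, of order \<open>sqrt m\<close>, linear in
        \<open>m\<close> with coefficient \<open>1/2\<close>; the size of \<open>G\<close> only
        affects the constant \<open>Q\<close>.\<close>
      also have "\<dots> \<le> (G\<^sup>2 + m) / 2"
        using zero_le_power2[of "G - sqrt m"] m1 by (simp add: power2_diff)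
      also have "m \<le> 1 + x"
        unfolding m_def using x by (intro real_le_lsqrt) (auto simp: power2_eq_square algebra_simps)
      finally have "8 * (H * L)\<^sup>2 \<le> (G\<^sup>2 + (1 + x)) / 2" by simp
      also have "\<dots> = (G\<^sup>2 + 1) / 2 + x / 2" by (simp add: add_divide_distrib)
      finally have "8 * (H * L)\<^sup>2 \<le> (G\<^sup>2 + 1) / 2 + x / 2" .
      then show ?thesis unfolding Q_def exp_add[symmetric] by simp
    qed
    finally show ?thesis
      by (simp add: M_def k_def edge_tail_def mult_left_mono)
  qed
  moreover have "Q > 0" by (simp add: Q_def)
  ultimately show ?thesis using that by blast
qed

section \<open>Integration over the contour of \<open>\<mu>\<close>\<close>

lemma cmod_ray_integral_1_le:
  assumes "\<And>r. r \<ge> 0 \<Longrightarrow> cmod (f (p + of_real r)) \<le> B * exp (- r / 2)" "B \<ge> 0"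
  shows "cmod (ray_integral p 1 f) \<le> 2 * B"
  unfolding ray_integral_def set_lebesgue_integral_def
proof (rule norm_lebesgue_integral_le)
  have "(\<integral>\<^sup>+r. ennreal (norm (indicat_real {0..} r *\<^sub>R (f (p + of_real r * 1) * 1))) \<partial>lborel)
      \<le> (\<integral>\<^sup>+r. ennreal (B * exp (- r / 2)) * indicator {0..} r \<partial>lborel)"
  proof (rule nn_integral_mono)
    show "ennreal (norm (indicat_real {0..} r *\<^sub>R (f (p + of_real r * 1) * 1)))
        \<le> ennreal (B * exp (- r / 2)) * indicator {0..} r" for r
      using assms(1)[of r] by (cases "r \<ge> 0") (auto intro: ennreal_leI)
  qed
  also have "\<dots> = ennreal (0 - (- 2 * B * exp (- 0 / 2)))"
  proof (rule nn_integral_FTC_atLeast)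
    show "((\<lambda>r. - 2 * B * exp (- r / 2)) has_real_derivative B * exp (- r / 2)) (at r)" for r
      by (auto intro!: derivative_eq_intros)
    have "((\<lambda>r::real. exp (- r / 2)) \<longlongrightarrow> 0) at_top" by real_asymp
    from tendsto_mult_left[OF this, of "- 2 * B"]
    show "((\<lambda>r. - 2 * B * exp (- r / 2)) \<longlongrightarrow> 0) at_top" by simp
  qed (use assms in auto)
  finally show "(\<integral>\<^sup>+r. ennreal (norm (indicat_real {0..} r *\<^sub>R (f (p + of_real r * 1) * 1))) \<partial>lborel) \<le> ennreal (2 * B)"
    by simp
qed (use assms in auto)

text \<open>Each ray contributes \<open>2 * B\<close>; the semicircle has length \<open>pi\<close>.
  The factor \<open>3\<close> there leaves room for \<open>exp (- z)\<close>, of modulus at most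
  \<open>exp 1\<close>.\<close>

lemma cmod_C_integral_le:
  assumes ray: "\<And>r \<sigma>. r \<ge> 0 \<Longrightarrow> \<bar>\<sigma>\<bar> = 1 \<Longrightarrow> cmod (f (Complex r \<sigma>)) \<le> B * exp (- r / 2)"
    and circ: "\<And>z. cmod z = 1 \<Longrightarrow> Re z \<le> 0 \<Longrightarrow> cmod (f z) \<le> 3 * B" and B: "B \<ge> 0"
  shows "cmod (C_integral f) \<le> (4 + 3 * pi) * B"
proof -
  define \<gamma> where "\<gamma> = part_circlepath 0 1 (pi / 2) (3 * pi / 2)"
  have "cmod (contour_integral \<gamma> f) \<le> 3 * B * pi"
  proof (cases "f contour_integrable_on \<gamma>")
    case True
    then have "(f has_contour_integral contour_integral \<gamma> f) \<gamma>"
      by (rule has_contour_integral_integral)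
    then have "cmod (contour_integral \<gamma> f) \<le> 3 * B * 1 * (3 * pi / 2 - pi / 2)"
      unfolding \<gamma>_def
    proof (rule has_contour_integral_bound_part_circlepath)
      fix z assume "z \<in> path_image (part_circlepath 0 1 (pi / 2) (3 * pi / 2))"
      then obtain t where t: "pi / 2 \<le> t" "t \<le> 3 * pi / 2" "z = exp (\<i> * of_real t)"
        by (auto simp: path_image_part_circlepath)
      then have "cos (t - pi) \<ge> 0" by (intro cos_ge_zero) auto
      then have "Re z \<le> 0" using t(3) by (simp add: Re_exp)
      then show "cmod (f z) \<le> 3 * B" using t(3) by (intro circ) auto
    qed (use B in auto)
    then show ?thesis by simp
  qed (use B in \<open>simp add: not_integrable_contour_integral\<close>)
  moreover have "cmod (ray_integral \<i> 1 f) \<le> 2 * B" "cmod (ray_integral (- \<i>) 1 f) \<le> 2 * B"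
  proof -
    have "\<i> + of_real r = Complex r 1" "- \<i> + of_real r = Complex r (- 1)" for r
      by (simp_all add: complex_eq_iff)
    then show "cmod (ray_integral \<i> 1 f) \<le> 2 * B" "cmod (ray_integral (- \<i>) 1 f) \<le> 2 * B"
      using ray B by (auto intro!: cmod_ray_integral_1_le)
  qed
  moreover have "cmod (C_integral f) \<le> cmod (ray_integral \<i> 1 f) + cmod (contour_integral \<gamma> f) + cmod (ray_integral (- \<i>) 1 f)"
    unfolding C_integral_def \<gamma>_def[symmetric]
    using norm_triangle_ineq[of "- ray_integral \<i> 1 f + contour_integral \<gamma> f" "ray_integral (- \<i>) 1 f"]
      norm_triangle_ineq[of "- ray_integral \<i> 1 f" "contour_integral \<gamma> f"] by simp
  ultimately show ?thesis by (simp add: algebra_simps)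
qed

theorem corollary1:
  fixes T0 :: real
  assumes "T0 > 0"
  shows "\<exists>c1 c2 c3 :: real. c1 > 0 \<and> c2 > 0 \<and> c3 > 0 \<and>
    (\<forall>T s :: real. T \<ge> T0 \<longrightarrow> s \<ge> 0 \<longrightarrow>
      1 - F_edge T s \<le> c1 * (exp (- c2 * T powr (1/3) * s) + exp (- c3 * s powr (3/2))))"
proof -
  obtain Q where Q: "Q > 0"
    "\<And>T s x \<mu>. T \<ge> T0 \<Longrightarrow> s \<ge> 0 \<Longrightarrow> x \<ge> 0 \<Longrightarrow> cmod \<mu> \<le> sqrt (1 + x\<^sup>2) \<Longrightarrow>
      (\<And>r. r \<ge> 0 \<Longrightarrow> sqrt (1 + (x - r)\<^sup>2) \<le> cmod (\<mu> - of_real r)) \<Longrightarrow>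
      cmod (fredholm_det (restrict_space lborel {s<..}) (K_edge_conj T \<mu>) - 1)
        \<le> edge_tail (kappa T) s * (Q * exp (x / 2))"
    using fredholm_det_K_edge_le[OF assms] by blast
  have main: "1 - F_edge T s \<le> 2 * Q * (exp (- (2 powr (- 1 / 3) / 32) * T powr (1 / 3) * s) + exp (- (1 / 16) * s powr (3 / 2)))"
    if T: "T \<ge> T0" and s: "s \<ge> 0" for T s
  proof -
    define d where "d \<mu> = fredholm_det (restrict_space lborel {s<..}) (K_edge_conj T \<mu>) - 1" for \<mu>
    define f where "f \<mu> = exp (- \<mu>) / \<mu> * d \<mu>" for \<mu>
    define B where "B = edge_tail (kappa T) s * Q"
    have B: "B \<ge> 0" using Q(1) by (simp add: B_def edge_tail_def)
    have "cmod (C_integral f) \<le> (4 + 3 * pi) * B"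
    proof (rule cmod_C_integral_le[OF _ _ B])
      fix r \<sigma> :: real assume r: "r \<ge> 0" and \<sigma>: "\<bar>\<sigma>\<bar> = 1"
      have \<sigma>2: "\<sigma>\<^sup>2 = 1" using \<sigma> by (simp flip: power2_abs[of \<sigma>])
      \<comment> \<open>On the rays the assumed lower bound for the distance to a nonnegative real
        holds with equality.\<close>
      have c: "cmod (Complex r \<sigma> - of_real u) = sqrt (1 + (r - u)\<^sup>2)" for u
        by (simp add: cmod_def \<sigma>2 add.commute)
      have "cmod (d (Complex r \<sigma>)) \<le> edge_tail (kappa T) s * (Q * exp (r / 2))"
        unfolding d_def using c c[of 0] r by (intro Q(2) T s) auto
      moreover have "cmod (exp (- Complex r \<sigma>) / Complex r \<sigma>) \<le> exp (- r) / 1"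
        unfolding norm_divide using c[of 0] by (intro frac_le) (auto simp: norm_exp_eq_Re)
      ultimately have "cmod (f (Complex r \<sigma>)) \<le> exp (- r) / 1 * (edge_tail (kappa T) s * (Q * exp (r / 2)))"
        unfolding f_def norm_mult by (intro mult_mono) auto
      also have "\<dots> = B * (exp (- r) * exp (r / 2))"
        by (simp add: B_def)
      also have "exp (- r) * exp (r / 2) = exp (- r / 2)"
        by (simp flip: exp_add)
      finally show "cmod (f (Complex r \<sigma>)) \<le> B * exp (- r / 2)" .
    next
      fix z assume z: "cmod z = 1" "Re z \<le> 0"
      \<comment> \<open>The squared distance is \<open>1 - 2 * r * Re z + r\<^sup>2\<close>, and
        \<open>Re z \<le> 0\<close> on the left semicircle; hence \<open>x = 0\<close> is
        admissible.\<close>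
      have "sqrt (1 + (0 - r)\<^sup>2) \<le> cmod (z - of_real r)" if "r \<ge> 0" for r
      proof -
        have "1 = (Re z)\<^sup>2 + (Im z)\<^sup>2" using z(1) cmod_power2[of z] by simp
        moreover have "r * Re z \<le> 0" using that z(2) by (simp add: mult_nonneg_nonpos)
        ultimately show ?thesis
          unfolding cmod_def by (simp add: power2_eq_square algebra_simps)
      qed
      then have "cmod (d z) \<le> edge_tail (kappa T) s * (Q * exp (0 / 2))"
        unfolding d_def using z by (intro Q(2) T s) auto
      then have "cmod (d z) \<le> B" by (simp add: B_def)
      moreover have "cmod (exp (- z) / z) \<le> 3"
      proof -
        have "- Re z \<le> 1" using abs_Re_le_cmod[of z] z by simp
        then have "exp (- Re z) \<le> exp 1" by simp
        also note exp_le
        finally show ?thesis using z by (simp add: norm_divide norm_exp_eq_Re)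
      qed
      ultimately show "cmod (f z) \<le> 3 * B"
        unfolding f_def norm_mult by (intro mult_mono) auto
    qed
    moreover have "1 - F_edge T s = Re (- (1 / (2 * of_real pi * \<i>)) * C_integral f)"
      unfolding F_edge_def f_def[abs_def] d_def by simp
    moreover have "Re (- (1 / (2 * of_real pi * \<i>)) * C_integral f) \<le> 1 / (2 * pi) * cmod (C_integral f)"
      by (rule order_trans[OF complex_Re_le_cmod]) (simp add: norm_mult norm_divide)
    ultimately have "1 - F_edge T s \<le> 1 / (2 * pi) * ((4 + 3 * pi) * B)"
      by (smt (verit) divide_nonneg_pos mult_left_mono pi_gt_zero)
    also have "\<dots> = (2 / pi + 3 / 2) * B"
      by (simp add: field_simps)
    also have "\<dots> \<le> 4 * B"
      using B pi_ge_two by (intro mult_right_mono) (auto simp: field_simps)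
    also have "\<dots> = 2 * Q * (exp (- (kappa T * s / 32)) + exp (- (s * sqrt s / 16)))"
      by (simp add: B_def edge_tail_def)
    also have "kappa T * s / 32 = 2 powr (- 1 / 3) / 32 * T powr (1 / 3) * s"
      by (simp add: kappa_def)
    also have "s * sqrt s = s powr (3 / 2)"
    proof (cases "s = 0")
      case False
      then have "s powr (1 + 1 / 2) = s * sqrt s"
        using s by (simp only: powr_add) (simp add: powr_half_sqrt)
      then show ?thesis by simp
    qed simp
    finally show ?thesis by simp
  qed
  \<comment> \<open>Only \<open>Q\<close> depends on \<open>T0\<close>. The rate
    \<open>2 powr (- 1 / 3) / 32\<close> combines the \<open>1/32\<close> of
    \<open>edge_tail\<close> with the constant in \<open>kappa\<close>.\<close>
  show ?thesis
    using main Q(1)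
    by (intro exI[of _ "2 * Q"] exI[of _ "2 powr (- 1 / 3) / 32"] exI[of _ "1 / 16"]) auto
qed

end
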